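(* Let $\alpha>0$, $\Delta>0$, $\mu>0$, and let $M^{(N)}$ be the stationary queue length in the $N$-scaled infinite-server system with scaling exponent $\alpha$ (defined in the context). Put $\gamma:=\max\{1,2-\alpha\}$ and $$\check M^{(N)}:=N^{-\gamma/2}\big(M^{(N)}-\mathbb{E}M^{(N)}\big).$$ Then, as $N\to\infty$, $\check M^{(N)}$ converges in distribution to a zero-mean normally distributed random variable with variance $$\sigma^2:=\frac{\mathbb{E}\Lambda}{\mu}\,1_{\{\alpha\ge 1\}}+\frac{\Delta\,\mathrm{Var}(\Lambda)}{2\mu}\,1_{\{\alpha\le 1\}}.$$
   Context: $\Lambda$ is a non-negative random variable with a density $f_\Lambda$ and finite first two moments; $\Lambda_0,\Lambda_1,\Lambda_2,\dots$ are i.i.d. copies of $\Lambda$. For $N\in\mathbb{N}$ define $$\Lambda^{(N)}(t):=\sum_{j=0}^\infty \Lambda_j\,1_{[j\Delta N^{-\alpha},(j+1)\Delta N^{-\alpha})}(t),\qquad t\ge 0.$$ The $N$-scaled system is an infinite-server queue with i.i.d. exponential service times of mean $1/\mu$ (independent of the arrivals), whose arrivals form a Cox process with random rate $N\Lambda^{(N)}(\cdot)$, i.e. the arrival rate is resampled independently, as $N$ times a copy of $\Lambda$, every $\Delta N^{-\alpha}$ time units. Its stationary queue length $M^{(N)}$ (number of jobs present, observed at a resampling epoch) is the mixed Poisson random variable which, conditionally on $(\Lambda_j)_{j\ge 0}$, is Poisson distributed with parameter $$N\int_0^\infty \Lambda^{(N)}(s)\,e^{-\mu s}\,\mathrm{d}s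 .$$ *)

theory Defs
  imports "HOL-Probability.Probability"
begin

(* "Ls j" are the i.i.d. copies of the random rate; the time grid has mesh \<Delta> * N powr (-\<alpha>).
   For every t at most one term of the series is nonzero. *)
definition resampled_rate ::
    "real \<Rightarrow> real \<Rightarrow> (nat \<Rightarrow> 'a \<Rightarrow> real) \<Rightarrow> nat \<Rightarrow> 'a \<Rightarrow> real \<Rightarrow> real" where
  "resampled_rate \<alpha> \<Delta> Ls N \<omega> t =
     (\<Sum>j. Ls j \<omega> *
        indicator {real j * \<Delta> * real N powr (-\<alpha>) ..< (real j + 1) * \<Delta> * real N powr (-\<alpha>)} t)"

(* On the null event where the integrand fails to be integrable, the value is 0 by convention. *)
definition queue_parameter ::
    "real \<Rightarrow> real \<Rightarrow> real \<Rightarrow> (nat \<Rightarrow> 'a \<Rightarrow> real) \<Rightarrow> nat \<Rightarrow> 'a \<Rightarrow> real" where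
  "queue_parameter \<alpha> \<Delta> \<mu> Ls N \<omega> =
     real N * (LBINT s:{0..}. resampled_rate \<alpha> \<Delta> Ls N \<omega> s * exp (- \<mu> * s))"

definition generated_by :: "'a measure \<Rightarrow> (nat \<Rightarrow> 'a \<Rightarrow> real) \<Rightarrow> 'a measure" where
  "generated_by M Ls =
     vimage_algebra (space M) (\<lambda>\<omega> j. Ls j \<omega>) (\<Pi>\<^sub>M j\<in>UNIV. (borel :: real measure))"

(* Q is Poisson with random parameter R, conditionally on the sub-sigma-algebra F.
   The Poisson weights are written out since the library's poisson_pmf is only
   characterised for strictly positive rates; here rate 0 gives the point mass at 0. *)
definition conditionally_poisson ::
    "'a measure \<Rightarrow> 'a measure \<Rightarrow> ('a \<Rightarrow> real) \<Rightarrow> ('a \<Rightarrow> nat) \<Rightarrow> bool" where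
  "conditionally_poisson M F R Q \<longleftrightarrow>
     Q \<in> measurable M (count_space UNIV) \<and>
     (\<forall>k. AE \<omega> in M. real_cond_exp M F (indicator {\<omega> \<in> space M. Q \<omega> = k}) \<omega>
                       = R \<omega> ^ k / fact k * exp (- R \<omega>))"

definition stationary_queue_length ::
    "'a measure \<Rightarrow> real \<Rightarrow> real \<Rightarrow> real \<Rightarrow> (nat \<Rightarrow> 'a \<Rightarrow> real) \<Rightarrow> nat \<Rightarrow> ('a \<Rightarrow> nat) \<Rightarrow> bool" where
  "stationary_queue_length M \<alpha> \<Delta> \<mu> Ls N Q \<longleftrightarrow>
     conditionally_poisson M (generated_by M Ls) (queue_parameter \<alpha> \<Delta> \<mu> Ls N) Q"

definition normalized_queue_length ::
    "'a measure \<Rightarrow> real \<Rightarrow> nat \<Rightarrow> ('a \<Rightarrow> nat) \<Rightarrow> 'a \<Rightarrow> real" where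
  "normalized_queue_length M \<alpha> N Q \<omega> =
     real N powr (- (max 1 (2 - \<alpha>)) / 2) * (real (Q \<omega>) - (\<integral>\<omega>'. real (Q \<omega>') \<partial>M))"

end

theory Submission
  imports Defs
begin

text \<open>
Conditionally on the resampled rates, the queue length is Poisson with a random parameter \<open>R\<close>,
and \<open>R\<close> is a geometrically weighted sum of the i.i.d. rates: the weight of the rate number
\<open>j\<close> is \<open>N\<close> times the integral of \<open>exp (- \<mu> * s)\<close> over the cell number \<open>j\<close> of the time grid.
The queue length therefore fluctuates for two reasons.

The first is the Poisson noise. The characteristic function of the queue length is the mean of
\<open>exp (R * (iexp s - 1))\<close>; expanding the exponent to second order and replacing \<open>R\<close> by its mean
\<open>m\<close> in the quadratic term splits off a Gaussian factor with variance \<open>m = N * l / \<mu>\<close>, where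
\<open>l\<close> is the mean rate (\<open>mixed_poisson_char_approx\<close>). What remains is the characteristic function
of \<open>R - m\<close>, the second source of randomness. This is a weighted sum of centered i.i.d. variables
in which no summand dominates, so it is nearly normal with variance \<open>V\<close>, the variance of a rate,
times the sum of the squared weights (\<open>series_char_approx\<close>), which is about
\<open>N\<^sup>2 * (\<Delta> * N powr (- \<alpha>)) / (2 * \<mu>)\<close>.

Together (\<open>stationary_queue_char_approx\<close>), the characteristic function of the centered queue
length is that of a normal variable whose variance adds the two contributions, of orders \<open>N\<close> and
\<open>N powr (2 - \<alpha>)\<close>, with an explicit error. Dividing the variance by \<open>N powr \<gamma>\<close>, where \<open>\<gamma>\<close> is
the larger of the two exponents, keeps the Poisson part exactly if \<open>\<alpha> \<ge> 1\<close> and the rate part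
exactly if \<open>\<alpha> \<le> 1\<close>, while the error vanishes. Levy's continuity theorem concludes.
\<close>

section \<open>Estimates for exponentials\<close>

text \<open>
The exponential has derivative of modulus at most \<open>1\<close> on the convex left half plane. Both
\<open>R * (iexp s - 1)\<close>, for \<open>R \<ge> 0\<close>, and its Gaussian replacement lie there, so an error in
the exponent costs no more than itself, whatever the size of \<open>R\<close>.
\<close>

lemma norm_exp_diff_le_of_Re_nonpos:
  fixes a b :: complex
  assumes "Re a \<le> 0" "Re b \<le> 0"
  shows "cmod (exp a - exp b) \<le> cmod (a - b)"
proof -
  have "cmod (exp a - exp b) \<le> 1 * cmod (a - b)"
  proof (rule field_differentiable_bound[where S = "{z. Re z \<le> 0}" and f' = exp])
    show "convex {z. Re z \<le> 0}" by (rule convex_halfspace_Re_le)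
  qed (use assms in \<open>auto intro!: derivative_eq_intros\<close>)
  then show ?thesis by simp
qed

lemma exp_minus_second_order:
  fixes u :: real
  assumes "0 \<le> u"
  shows "\<bar>exp (-u) - (1 - u)\<bar> \<le> u\<^sup>2 / 2"
proof -
  have "1 - u \<le> exp (-u)" using exp_ge_add_one_self[of "-u"] by simp
  moreover have "exp (-u) \<le> 1 - u + u\<^sup>2 / 2"
  proof -
    obtain t where t: "\<bar>t\<bar> \<le> \<bar>-u\<bar>"
      "exp (-u) = (\<Sum>m<3. (-u) ^ m / fact m) + exp t / fact 3 * (-u) ^ 3"
      using Maclaurin_exp_le[of "-u" 3] by blast
    have "exp t / fact 3 * (-u) ^ 3 \<le> 0" using assms by (simp add: mult_nonneg_nonpos power_less_zero_eq)
    then show ?thesis using t(2) by (simp add: eval_nat_numeral)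
  qed
  ultimately show ?thesis by simp
qed

lemma iexp_second_order:
  "cmod (iexp s - 1 - \<i> * s + s\<^sup>2 / 2) \<le> \<bar>s\<bar> ^ 3 / 6"
proof -
  have "(\<Sum>k\<le>2. (\<i> * complex_of_real s) ^ k / fact k) = 1 + \<i> * s - s\<^sup>2 / 2"
    by (simp add: eval_nat_numeral algebra_simps)
  with iexp_approx1[of s 2] show ?thesis
    by (simp add: eval_nat_numeral algebra_simps)
qed

lemma poisson_weight_le_1:
  fixes r :: real
  assumes "0 \<le> r"
  shows "r ^ k / fact k * exp (- r) \<le> 1"
proof -
  have "r ^ k / fact k = (\<Sum>n\<in>{k}. r ^ n /\<^sub>R fact n)" by (simp add: field_simps)
  also have "\<dots> \<le> exp r"
    unfolding exp_def using assms by (intro sum_le_suminf summable_exp_generic) auto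
  finally show ?thesis
    by (metis exp_ge_zero exp_minus_inverse mult.commute mult_right_mono)
qed

section \<open>Mixed Poisson variables\<close>

context prob_space
begin

lemma integrable_poisson_weight:
  fixes R :: "'a \<Rightarrow> real"
  assumes [measurable]: "random_variable borel R" and "AE \<omega> in M. 0 \<le> R \<omega>"
  shows "integrable M (\<lambda>\<omega>. R \<omega> ^ k / fact k * exp (- R \<omega>))"
proof (rule integrable_const_bound[where B = 1])
  show "AE \<omega> in M. norm (R \<omega> ^ k / fact k * exp (- R \<omega>)) \<le> 1"
    using assms(2)
  proof eventually_elim
    case (elim \<omega>)
    then show ?case using poisson_weight_le_1[OF elim, of k] by (simp add: abs_mult)
  qed
qed measurable

text \<open>
The law of a mixed Poisson variable is an average of Poisson laws, so expectations of functions of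
\<open>Q\<close> are averages of Poisson expectations. Convergence in distribution concerns only this
law, which is why the hypothesis on \<open>Q\<close> is about its point probabilities.
\<close>

lemma mixed_poisson_nn_integral:
  fixes Q :: "'a \<Rightarrow> nat" and R :: "'a \<Rightarrow> real" and g :: "nat \<Rightarrow> ennreal"
  assumes [measurable]: "Q \<in> measurable M (count_space UNIV)" "random_variable borel R"
    and R_nonneg: "AE \<omega> in M. 0 \<le> R \<omega>"
    and weights: "\<And>k. prob {\<omega> \<in> space M. Q \<omega> = k} = expectation (\<lambda>\<omega>. R \<omega> ^ k / fact k * exp (- R \<omega>))"
  shows "(\<integral>\<^sup>+ \<omega>. g (Q \<omega>) \<partial>M) = (\<integral>\<^sup>+ \<omega>. (\<Sum>k. g k * ennreal (R \<omega> ^ k / fact k * exp (- R \<omega>))) \<partial>M)"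
proof -
  have "(\<integral>\<^sup>+ \<omega>. g (Q \<omega>) \<partial>M) = (\<integral>\<^sup>+ \<omega>. (\<Sum>k. g k * indicator {\<omega> \<in> space M. Q \<omega> = k} \<omega>) \<partial>M)"
  proof (rule nn_integral_cong)
    fix \<omega> assume "\<omega> \<in> space M"
    have "(\<Sum>k. g k * indicator {\<omega> \<in> space M. Q \<omega> = k} \<omega>) = (\<Sum>k\<in>{Q \<omega>}. g k * indicator {\<omega> \<in> space M. Q \<omega> = k} \<omega>)"
      by (rule suminf_finite) (auto simp: indicator_def)
    then show "g (Q \<omega>) = (\<Sum>k. g k * indicator {\<omega> \<in> space M. Q \<omega> = k} \<omega>)"
      using \<open>\<omega> \<in> space M\<close> by simp
  qed
  also have "\<dots> = (\<Sum>k. g k * emeasure M {\<omega> \<in> space M. Q \<omega> = k})"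
    by (simp add: nn_integral_suminf nn_integral_cmult)
  also have "\<dots> = (\<Sum>k. g k * (\<integral>\<^sup>+ \<omega>. ennreal (R \<omega> ^ k / fact k * exp (- R \<omega>)) \<partial>M))"
  proof (intro suminf_cong arg_cong2[where f = "(*)"] refl)
    fix k
    show "emeasure M {\<omega> \<in> space M. Q \<omega> = k} = (\<integral>\<^sup>+ \<omega>. ennreal (R \<omega> ^ k / fact k * exp (- R \<omega>)) \<partial>M)"
      unfolding emeasure_eq_measure weights
      by (rule nn_integral_eq_integral[OF integrable_poisson_weight[OF assms(2) R_nonneg], symmetric]) (use R_nonneg in eventually_elim, simp)
  qed
  also have "\<dots> = (\<integral>\<^sup>+ \<omega>. (\<Sum>k. g k * ennreal (R \<omega> ^ k / fact k * exp (- R \<omega>))) \<partial>M)"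
    by (simp add: nn_integral_suminf nn_integral_cmult)
  finally show ?thesis .
qed

lemma mixed_poisson_mean:
  fixes Q :: "'a \<Rightarrow> nat" and R :: "'a \<Rightarrow> real"
  assumes [measurable]: "Q \<in> measurable M (count_space UNIV)" and R_int: "integrable M R"
    and R_nonneg: "AE \<omega> in M. 0 \<le> R \<omega>"
    and weights: "\<And>k. prob {\<omega> \<in> space M. Q \<omega> = k} = expectation (\<lambda>\<omega>. R \<omega> ^ k / fact k * exp (- R \<omega>))"
  shows "expectation (\<lambda>\<omega>. real (Q \<omega>)) = expectation R"
proof -
  have [measurable]: "random_variable borel R" using R_int by simp
  have sums: "(\<lambda>k. real k * (r ^ k / fact k * exp (- r))) sums r" for r :: real
  proof -
    have "(\<lambda>k. r ^ k /\<^sub>R fact k * (r * exp (- r))) sums (exp r * (r * exp (- r)))"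
      by (intro sums_mult2 exp_converges)
    moreover have "r ^ k /\<^sub>R fact k * (r * exp (- r)) = real (Suc k) * (r ^ Suc k / fact (Suc k) * exp (- r))" for k
      by (simp add: field_simps del: of_nat_Suc)
    moreover have "exp r * (r * exp (- r)) = r" by (simp add: exp_minus)
    ultimately have "(\<lambda>k. real (Suc k) * (r ^ Suc k / fact (Suc k) * exp (- r))) sums r" by simp
    from sums_Suc_imp[OF _ this] show ?thesis by simp
  qed
  have "(\<integral>\<^sup>+ \<omega>. ennreal (real (Q \<omega>)) \<partial>M) =
      (\<integral>\<^sup>+ \<omega>. (\<Sum>k. ennreal (real k) * ennreal (R \<omega> ^ k / fact k * exp (- R \<omega>))) \<partial>M)"
    by (rule mixed_poisson_nn_integral) (use assms in auto)
  also have "\<dots> = (\<integral>\<^sup>+ \<omega>. ennreal (R \<omega>) \<partial>M)"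
  proof (rule nn_integral_cong_AE)
    show "AE \<omega> in M. (\<Sum>k. ennreal (real k) * ennreal (R \<omega> ^ k / fact k * exp (- R \<omega>))) = ennreal (R \<omega>)"
      using R_nonneg
    proof eventually_elim
      case (elim \<omega>)
      have "(\<Sum>k. ennreal (real k) * ennreal (R \<omega> ^ k / fact k * exp (- R \<omega>))) =
        (\<Sum>k. ennreal (real k * (R \<omega> ^ k / fact k * exp (- R \<omega>))))"
        using elim by (intro suminf_cong ennreal_mult[symmetric]) auto
      also have "\<dots> = ennreal (R \<omega>)"
        using elim by (intro suminf_ennreal_eq sums) auto
      finally show ?case .
    qed
  qed
  finally have eq: "(\<integral>\<^sup>+ \<omega>. ennreal (real (Q \<omega>)) \<partial>M) = (\<integral>\<^sup>+ \<omega>. ennreal (R \<omega>) \<partial>M)" .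
  then show ?thesis
    by (subst (1 2) integral_eq_nn_integral) (use R_nonneg in auto)
qed

text \<open>
The characteristic function of a Poisson law of rate \<open>r\<close> is \<open>exp (r * (iexp s - 1))\<close>;
averaging over the random rate gives that of \<open>Q\<close>. The two exchanges of sum and integral rest
on the same dominating series, the point probabilities of \<open>Q\<close>.
\<close>

lemma mixed_poisson_iexp:
  fixes Q :: "'a \<Rightarrow> nat" and R :: "'a \<Rightarrow> real"
  assumes [measurable]: "Q \<in> measurable M (count_space UNIV)" "random_variable borel R"
    and R_nonneg: "AE \<omega> in M. 0 \<le> R \<omega>"
    and weights: "\<And>k. prob {\<omega> \<in> space M. Q \<omega> = k} = expectation (\<lambda>\<omega>. R \<omega> ^ k / fact k * exp (- R \<omega>))"
  shows "(CLINT \<omega>|M. iexp (s * real (Q \<omega>))) = (CLINT \<omega>|M. exp (R \<omega> * (iexp s - 1)))"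
proof -
  let ?A = "\<lambda>k. {\<omega> \<in> space M. Q \<omega> = k}"
  let ?p = "\<lambda>k \<omega>. R \<omega> ^ k / fact k * exp (- R \<omega>)"
  note int = integrable_poisson_weight[OF assms(2) R_nonneg]
  have "(\<lambda>k. prob (?A k)) sums prob (\<Union>k. ?A k)"
    by (rule finite_measure_UNION) (auto simp: disjoint_family_on_def)
  then have summable: "summable (\<lambda>k. prob (?A k))" by (rule sums_summable)
  have norm_ind: "(\<lambda>\<omega>. norm (iexp (s * real k) * indicator (?A k) \<omega>)) = (indicator (?A k) :: 'a \<Rightarrow> real)" for k
    by (auto simp: norm_mult indicator_def)
  have "(\<lambda>k. CLINT \<omega>|M. iexp (s * real k) * indicator (?A k) \<omega>) sums
      (CLINT \<omega>|M. (\<Sum>k. iexp (s * real k) * indicator (?A k) \<omega>))"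
  proof (rule sums_integral)
    show "AE \<omega> in M. summable (\<lambda>k. norm (iexp (s * real k) * indicator (?A k) \<omega>))"
    proof (rule AE_I2)
      fix \<omega> show "summable (\<lambda>k. norm (iexp (s * real k) * indicator (?A k) \<omega>))"
        by (rule summable_finite[of "{Q \<omega>}"]) (auto simp: indicator_def)
    qed
    show "summable (\<lambda>k. LINT \<omega>|M. norm (iexp (s * real k) * indicator (?A k) \<omega>))"
      unfolding norm_ind using summable by simp
    show "integrable M (\<lambda>\<omega>. iexp (s * real k) * indicator (?A k) \<omega>)" for k
      by (rule integrable_const_bound[where B = 1]) (auto simp: norm_mult indicator_def)
  qed
  also have "(CLINT \<omega>|M. (\<Sum>k. iexp (s * real k) * indicator (?A k) \<omega>)) = (CLINT \<omega>|M. iexp (s * real (Q \<omega>)))"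
  proof (rule Bochner_Integration.integral_cong[OF refl])
    fix \<omega> assume "\<omega> \<in> space M"
    have "(\<Sum>k. iexp (s * real k) * indicator (?A k) \<omega>) = (\<Sum>k\<in>{Q \<omega>}. iexp (s * real k) * indicator (?A k) \<omega>)"
      by (rule suminf_finite) (auto simp: indicator_def)
    then show "(\<Sum>k. iexp (s * real k) * indicator (?A k) \<omega>) = iexp (s * real (Q \<omega>))"
      using \<open>\<omega> \<in> space M\<close> by simp
  qed
  also have "(\<lambda>k. CLINT \<omega>|M. iexp (s * real k) * indicator (?A k) \<omega>) = (\<lambda>k. CLINT \<omega>|M. iexp (s * real k) * ?p k \<omega>)"
  proof
    fix k
    have "(CLINT \<omega>|M. iexp (s * real k) * indicator (?A k) \<omega>) = iexp (s * real k) * (CLINT \<omega>|M. of_real (indicator (?A k) \<omega>))"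
      by (subst integral_mult_right_zero[symmetric], rule arg_cong[where f = "integral\<^sup>L M"]) (auto simp: indicator_def)
    also have "\<dots> = iexp (s * real k) * of_real (prob (?A k))"
      by simp
    also have "\<dots> = iexp (s * real k) * (CLINT \<omega>|M. of_real (?p k \<omega>))"
      unfolding weights integral_complex_of_real ..
    finally show "(CLINT \<omega>|M. iexp (s * real k) * indicator (?A k) \<omega>) = (CLINT \<omega>|M. iexp (s * real k) * ?p k \<omega>)"
      by (simp only: integral_mult_right_zero)
  qed
  finally have left: "(\<lambda>k. CLINT \<omega>|M. iexp (s * real k) * ?p k \<omega>) sums (CLINT \<omega>|M. iexp (s * real (Q \<omega>)))" .
  have series: "(\<lambda>k. iexp (s * real k) * complex_of_real (r ^ k / fact k * exp (- r))) sums exp (r * (iexp s - 1))" for r :: real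
  proof -
    have "(\<lambda>k. (r * iexp s) ^ k /\<^sub>R fact k * exp (- of_real r)) sums (exp (r * iexp s) * exp (- of_real r))"
      by (intro sums_mult2 exp_converges)
    moreover have "(r * iexp s) ^ k /\<^sub>R fact k * exp (- of_real r) = iexp (s * real k) * complex_of_real (r ^ k / fact k * exp (- r))" for k
      by (simp add: power_mult_distrib exp_of_nat_mult[symmetric] exp_of_real[symmetric] scaleR_conv_of_real field_simps)
    ultimately show ?thesis
      by (simp add: exp_add[symmetric] algebra_simps)
  qed
  have norm_p: "AE \<omega> in M. \<forall>k. norm (iexp (s * real k) * complex_of_real (?p k \<omega>)) = ?p k \<omega>"
    using R_nonneg by eventually_elim (auto simp: norm_mult norm_divide norm_power)
  have "(\<lambda>k. CLINT \<omega>|M. iexp (s * real k) * ?p k \<omega>) sums (CLINT \<omega>|M. (\<Sum>k. iexp (s * real k) * ?p k \<omega>))"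
  proof (rule sums_integral)
    show "integrable M (\<lambda>\<omega>. iexp (s * real k) * complex_of_real (?p k \<omega>))" for k
      by (intro integrable_mult_right integrable_of_real int)
    show "AE \<omega> in M. summable (\<lambda>k. norm (iexp (s * real k) * complex_of_real (?p k \<omega>)))"
      using norm_p
    proof eventually_elim
      case (elim \<omega>)
      have "summable (\<lambda>k. R \<omega> ^ k /\<^sub>R fact k * exp (- R \<omega>))"
        by (intro summable_mult2 summable_exp_generic)
      then show ?case unfolding elim[rule_format] by (simp add: field_simps)
    qed
    have "(LINT \<omega>|M. norm (iexp (s * real k) * complex_of_real (?p k \<omega>))) = prob (?A k)" for k
      unfolding weights using norm_p by (intro integral_cong_AE) auto
    then show "summable (\<lambda>k. LINT \<omega>|M. norm (iexp (s * real k) * complex_of_real (?p k \<omega>)))"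
      using summable by simp
  qed
  also have "(CLINT \<omega>|M. (\<Sum>k. iexp (s * real k) * ?p k \<omega>)) = (CLINT \<omega>|M. exp (R \<omega> * (iexp s - 1)))"
    by (simp only: sums_unique[OF series, symmetric])
  finally show ?thesis using left sums_unique2 by blast
qed

text \<open>
Conditionally on the rate, \<open>Q\<close> is close to a normal variable with mean and variance \<open>R\<close>:
the exponent \<open>R * (iexp s - 1)\<close> is \<open>\<i> * s * R - s\<^sup>2 * R / 2\<close> up to a cubic error. In the
quadratic term \<open>R\<close> may be replaced by its mean \<open>m\<close>, at the price of the standard deviation
of \<open>R\<close>. So the Poisson noise contributes a Gaussian factor with variance \<open>m\<close>, which
multiplies the characteristic function of the fluctuation \<open>R - m\<close> of the rate.
\<close>

lemma mixed_poisson_char_approx: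
  fixes Q :: "'a \<Rightarrow> nat" and R :: "'a \<Rightarrow> real"
  assumes [measurable]: "Q \<in> measurable M (count_space UNIV)" and R_int [simp]: "integrable M R"
    and R2_int [simp]: "integrable M (\<lambda>\<omega>. (R \<omega>)\<^sup>2)"
    and R_nonneg: "AE \<omega> in M. 0 \<le> R \<omega>"
    and weights: "\<And>k. prob {\<omega> \<in> space M. Q \<omega> = k} = expectation (\<lambda>\<omega>. R \<omega> ^ k / fact k * exp (- R \<omega>))"
  defines "m \<equiv> expectation R"
  shows "cmod ((CLINT \<omega>|M. iexp (s * (real (Q \<omega>) - m))) - exp (- (s\<^sup>2 * m / 2)) * (CLINT \<omega>|M. iexp (s * (R \<omega> - m))))
    \<le> \<bar>s\<bar> ^ 3 * m / 6 + s\<^sup>2 / 2 * sqrt (variance R)"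
proof -
  have [measurable]: "random_variable borel R" using R_int by (rule borel_measurable_integrable)
  have m_nonneg: "0 \<le> m" unfolding m_def by (rule integral_nonneg_AE[OF R_nonneg])
  define z where "z = iexp s - 1"
  have Re_z: "Re z \<le> 0" unfolding z_def by (simp add: Re_exp)
  let ?u = "s\<^sup>2 * m / 2"
  let ?P = "\<lambda>\<omega>. exp (R \<omega> * z)" and ?G = "\<lambda>\<omega>. exp (\<i> * s * R \<omega> - ?u)"
  have intP: "integrable M ?P" and intG: "integrable M ?G"
  proof -
    show "integrable M ?P"
    proof (rule integrable_const_bound[where B = 1])
      show "AE \<omega> in M. norm (?P \<omega>) \<le> 1"
        using R_nonneg by eventually_elim (use Re_z in \<open>simp add: norm_exp_eq_Re mult_nonneg_nonpos\<close>)
    qed measurable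
    show "integrable M ?G"
      by (rule integrable_const_bound[where B = 1]) (use m_nonneg in \<open>auto simp: norm_exp_eq_Re\<close>)
  qed
  have "(CLINT \<omega>|M. iexp (s * (real (Q \<omega>) - m))) = (CLINT \<omega>|M. iexp (- s * m) * iexp (s * real (Q \<omega>)))"
    by (simp add: exp_add[symmetric] algebra_simps)
  also have "\<dots> = iexp (- s * m) * (CLINT \<omega>|M. ?P \<omega>)"
    unfolding integral_mult_right_zero z_def mixed_poisson_iexp[OF assms(1) \<open>random_variable borel R\<close> R_nonneg weights] ..
  finally have Q_eq: "(CLINT \<omega>|M. iexp (s * (real (Q \<omega>) - m))) = iexp (- s * m) * (CLINT \<omega>|M. ?P \<omega>)" .
  have "exp (- ?u) * (CLINT \<omega>|M. iexp (s * (R \<omega> - m))) = (CLINT \<omega>|M. exp (- ?u) * iexp (s * (R \<omega> - m)))"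
    by (simp only: integral_mult_right_zero)
  also have "\<dots> = (CLINT \<omega>|M. iexp (- s * m) * ?G \<omega>)"
    by (simp add: exp_add[symmetric] exp_of_real[symmetric] algebra_simps)
  also have "\<dots> = iexp (- s * m) * (CLINT \<omega>|M. ?G \<omega>)"
    by (simp only: integral_mult_right_zero)
  finally have R_eq: "exp (- ?u) * (CLINT \<omega>|M. iexp (s * (R \<omega> - m))) = iexp (- s * m) * (CLINT \<omega>|M. ?G \<omega>)" .
  have dev_int: "integrable M (\<lambda>\<omega>. \<bar>R \<omega> - m\<bar>)" by simp
  \<comment> \<open>Jensen's inequality for the square, in the form that the variance of the absolute deviation is nonnegative.\<close>
  have dev: "expectation (\<lambda>\<omega>. \<bar>R \<omega> - m\<bar>) \<le> sqrt (variance R)"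
  proof (rule real_le_rsqrt)
    have sq: "integrable M (\<lambda>\<omega>. \<bar>R \<omega> - m\<bar>\<^sup>2)" by (simp add: power2_diff)
    show "(expectation (\<lambda>\<omega>. \<bar>R \<omega> - m\<bar>))\<^sup>2 \<le> variance R"
      using variance_eq[OF dev_int sq] variance_positive[of "\<lambda>\<omega>. \<bar>R \<omega> - m\<bar>"]
      by (simp add: m_def)
  qed
  have "cmod ((CLINT \<omega>|M. iexp (s * (real (Q \<omega>) - m))) - exp (- ?u) * (CLINT \<omega>|M. iexp (s * (R \<omega> - m))))
     = cmod (CLINT \<omega>|M. ?P \<omega> - ?G \<omega>)"
    unfolding Q_eq R_eq right_diff_distrib[symmetric] norm_mult Bochner_Integration.integral_diff[OF intP intG]
    by simp
  also have "\<dots> \<le> expectation (\<lambda>\<omega>. cmod (?P \<omega> - ?G \<omega>))"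
    by (rule integral_norm_bound)
  also have "\<dots> \<le> expectation (\<lambda>\<omega>. \<bar>s\<bar> ^ 3 / 6 * R \<omega> + s\<^sup>2 / 2 * \<bar>R \<omega> - m\<bar>)"
  proof (rule integral_mono_AE)
    show "AE \<omega> in M. cmod (?P \<omega> - ?G \<omega>) \<le> \<bar>s\<bar> ^ 3 / 6 * R \<omega> + s\<^sup>2 / 2 * \<bar>R \<omega> - m\<bar>"
      using R_nonneg
    proof eventually_elim
      case (elim \<omega>)
      have "cmod (?P \<omega> - ?G \<omega>) \<le> cmod (R \<omega> * z - (\<i> * s * R \<omega> - ?u))"
        by (rule norm_exp_diff_le_of_Re_nonpos) (use elim Re_z m_nonneg in \<open>auto simp: mult_nonneg_nonpos\<close>)
      also have "R \<omega> * z - (\<i> * s * R \<omega> - ?u) =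
          R \<omega> * (iexp s - 1 - \<i> * s + s\<^sup>2 / 2) - of_real (s\<^sup>2 / 2 * (R \<omega> - m))"
        by (simp add: z_def field_simps)
      also have "cmod \<dots> \<le> cmod (R \<omega> * (iexp s - 1 - \<i> * s + s\<^sup>2 / 2)) + cmod (of_real (s\<^sup>2 / 2 * (R \<omega> - m)))"
        by (rule norm_triangle_ineq4)
      also have "\<dots> = R \<omega> * cmod (iexp s - 1 - \<i> * s + s\<^sup>2 / 2) + s\<^sup>2 / 2 * \<bar>R \<omega> - m\<bar>"
        unfolding norm_mult norm_of_real using elim by (simp add: abs_mult)
      also have "\<dots> \<le> R \<omega> * (\<bar>s\<bar> ^ 3 / 6) + s\<^sup>2 / 2 * \<bar>R \<omega> - m\<bar>"
        using elim by (intro add_right_mono mult_left_mono iexp_second_order)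
      finally show ?case by (simp add: mult.commute)
    qed
    show "integrable M (\<lambda>\<omega>. \<bar>s\<bar> ^ 3 / 6 * R \<omega> + s\<^sup>2 / 2 * \<bar>R \<omega> - m\<bar>)"
      using dev_int by simp
    show "integrable M (\<lambda>\<omega>. cmod (?P \<omega> - ?G \<omega>))"
      using intP intG by (intro integrable_norm Bochner_Integration.integrable_diff)
  qed
  also have "\<dots> = \<bar>s\<bar> ^ 3 / 6 * m + s\<^sup>2 / 2 * expectation (\<lambda>\<omega>. \<bar>R \<omega> - m\<bar>)"
    using dev_int by (simp add: m_def)
  also have "\<dots> \<le> \<bar>s\<bar> ^ 3 / 6 * m + s\<^sup>2 / 2 * sqrt (variance R)"
    using dev by (intro add_left_mono mult_left_mono) auto
  finally show ?thesis by (simp add: exp_of_real[symmetric])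
qed

end

section \<open>Weighted sums of centered i.i.d. variables\<close>

context prob_space
begin

lemma AE_summable_of_summable_expectation:
  fixes Z :: "nat \<Rightarrow> 'a \<Rightarrow> real"
  assumes int: "\<And>j. integrable M (Z j)" and summable: "summable (\<lambda>j. expectation (\<lambda>\<omega>. \<bar>Z j \<omega>\<bar>))"
  shows "AE \<omega> in M. summable (\<lambda>j. \<bar>Z j \<omega>\<bar>)"
proof -
  have [measurable]: "random_variable borel (Z j)" for j using int by (rule borel_measurable_integrable)
  have "(\<integral>\<^sup>+ \<omega>. (\<Sum>j. ennreal \<bar>Z j \<omega>\<bar>) \<partial>M) = (\<Sum>j. \<integral>\<^sup>+ \<omega>. ennreal \<bar>Z j \<omega>\<bar> \<partial>M)"
    by (rule nn_integral_suminf) measurable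
  also have "\<dots> = (\<Sum>j. ennreal (expectation (\<lambda>\<omega>. \<bar>Z j \<omega>\<bar>)))"
  proof (rule suminf_cong)
    show "(\<integral>\<^sup>+ \<omega>. ennreal \<bar>Z j \<omega>\<bar> \<partial>M) = ennreal (expectation (\<lambda>\<omega>. \<bar>Z j \<omega>\<bar>))" for j
      by (rule nn_integral_eq_integral) (simp_all add: int)
  qed
  also have "\<dots> \<noteq> \<infinity>"
    unfolding infinity_ennreal_def by (rule ennreal_suminf_neq_top[OF summable]) simp
  finally have "AE \<omega> in M. (\<Sum>j. ennreal \<bar>Z j \<omega>\<bar>) \<noteq> \<infinity>"
    by (rule nn_integral_noteq_infinite[rotated]) measurable
  then show ?thesis
  proof eventually_elim
    case (elim \<omega>)
    then show ?case
      unfolding infinity_ennreal_def by (rule summable_suminf_not_top[rotated]) simp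
  qed
qed

end

text \<open>
The setting of the central limit theorem. The weighted sums formed from the \<open>Y j\<close> are infinite
series, because the queue remembers all past rates, with geometrically decreasing influence.
\<close>

locale iid_centered = prob_space +
  fixes Y :: "nat \<Rightarrow> 'a \<Rightarrow> real" and V :: real
  assumes indep: "indep_vars (\<lambda>_. borel) Y UNIV"
    and ident: "\<And>j. distr M borel (Y j) = distr M borel (Y 0)"
    and sq_integrable: "integrable M (\<lambda>\<omega>. (Y 0 \<omega>)\<^sup>2)"
    and mean_zero: "expectation (Y 0) = 0"
    and V_eq: "V = expectation (\<lambda>\<omega>. (Y 0 \<omega>)\<^sup>2)"
begin

lemma Y_measurable [measurable]: "random_variable borel (Y j)"
  using indep by (simp add: indep_vars_def)

lemma transfer_integrable:
  fixes g :: "real \<Rightarrow> real"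
  assumes [measurable]: "g \<in> borel_measurable borel" and "integrable M (\<lambda>\<omega>. g (Y 0 \<omega>))"
  shows "integrable M (\<lambda>\<omega>. g (Y j \<omega>))"
proof -
  have "integrable (distr M borel (Y 0)) g"
    using assms(2) by (subst integrable_distr_eq) auto
  then have "integrable (distr M borel (Y j)) g"
    unfolding ident[of j] .
  then show ?thesis
    by (subst (asm) integrable_distr_eq) auto
qed

lemma transfer_expectation:
  fixes g :: "real \<Rightarrow> real"
  assumes [measurable]: "g \<in> borel_measurable borel"
  shows "expectation (\<lambda>\<omega>. g (Y j \<omega>)) = expectation (\<lambda>\<omega>. g (Y 0 \<omega>))"
proof -
  have "expectation (\<lambda>\<omega>. g (Y j \<omega>)) = integral\<^sup>L (distr M borel (Y j)) g"
    by (subst integral_distr) auto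
  also have "\<dots> = expectation (\<lambda>\<omega>. g (Y 0 \<omega>))"
    unfolding ident[of j] by (subst integral_distr) auto
  finally show ?thesis .
qed

lemma V_nonneg: "0 \<le> V"
  unfolding V_eq by simp

lemma integrable_Y [simp]: "integrable M (Y j)"
  by (rule transfer_integrable[where g = "\<lambda>x. x", OF _ square_integrable_imp_integrable[OF _ sq_integrable]]) auto

lemma integrable_Y_sq [simp]: "integrable M (\<lambda>\<omega>. (Y j \<omega>)\<^sup>2)"
  by (rule transfer_integrable[OF _ sq_integrable]) simp

lemma expectation_Y [simp]: "expectation (Y j) = 0"
  using transfer_expectation[where g = "\<lambda>x. x" and j = j] unfolding mean_zero by simp

lemma expectation_Y_sq [simp]: "expectation (\<lambda>\<omega>. (Y j \<omega>)\<^sup>2) = V"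
  unfolding V_eq by (rule transfer_expectation[where g = "\<lambda>x. x\<^sup>2"]) simp

lemma indep_weighted: "indep_vars (\<lambda>_. borel) (\<lambda>j \<omega>. b j * Y j \<omega>) J" for b :: "nat \<Rightarrow> real"
  by (rule indep_vars_compose2[where X = Y and Y = "\<lambda>j x. b j * x", OF indep_vars_subset[OF indep]]) auto

text \<open>
The cross terms vanish because \<open>Y n\<close> is independent of the preceding partial sum and centered.
\<close>

lemma partial_sum_second_moment:
  fixes b :: "nat \<Rightarrow> real"
  shows "integrable M (\<lambda>\<omega>. (\<Sum>j<n. b j * Y j \<omega>)\<^sup>2) \<and>
    expectation (\<lambda>\<omega>. (\<Sum>j<n. b j * Y j \<omega>)\<^sup>2) = V * (\<Sum>j<n. (b j)\<^sup>2)"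
proof (induction n)
  case 0
  then show ?case by simp
next
  case (Suc n)
  let ?S = "\<lambda>\<omega>. \<Sum>j<n. b j * Y j \<omega>"
  have "indep_var borel (\<lambda>\<omega>. b n * Y n \<omega>) borel ?S"
    by (rule indep_vars_sum[OF _ _ indep_weighted]) auto
  from indep_var_lebesgue_integral[OF this] indep_var_integrable[OF this]
  have cross: "expectation (\<lambda>\<omega>. b n * Y n \<omega> * ?S \<omega>) = 0" "integrable M (\<lambda>\<omega>. b n * Y n \<omega> * ?S \<omega>)"
    by simp_all
  have expand: "(\<Sum>j<Suc n. b j * Y j \<omega>)\<^sup>2 = (?S \<omega>)\<^sup>2 + 2 * (b n * Y n \<omega> * ?S \<omega>) + (b n)\<^sup>2 * (Y n \<omega>)\<^sup>2" for \<omega>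
    by (simp add: power2_eq_square algebra_simps)
  have i1: "integrable M (\<lambda>\<omega>. (?S \<omega>)\<^sup>2 + 2 * (b n * Y n \<omega> * ?S \<omega>))"
    using Suc cross(2) by (intro Bochner_Integration.integrable_add integrable_mult_right) auto
  have i2: "integrable M (\<lambda>\<omega>. (b n)\<^sup>2 * (Y n \<omega>)\<^sup>2)" by simp
  have "expectation (\<lambda>\<omega>. (?S \<omega>)\<^sup>2 + 2 * (b n * Y n \<omega> * ?S \<omega>) + (b n)\<^sup>2 * (Y n \<omega>)\<^sup>2) =
    expectation (\<lambda>\<omega>. (?S \<omega>)\<^sup>2) + expectation (\<lambda>\<omega>. 2 * (b n * Y n \<omega> * ?S \<omega>)) + expectation (\<lambda>\<omega>. (b n)\<^sup>2 * (Y n \<omega>)\<^sup>2)"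
    using Suc cross(2) i1 i2
    by (subst Bochner_Integration.integral_add, simp, simp, subst Bochner_Integration.integral_add) auto
  also have "\<dots> = V * (\<Sum>j<Suc n. (b j)\<^sup>2)"
    unfolding integral_mult_right_zero cross(1) using Suc by (simp add: algebra_simps)
  finally show ?case
    unfolding expand using Bochner_Integration.integrable_add[OF i1 i2] by blast
qed

context
  fixes b :: "nat \<Rightarrow> real" and \<beta> :: real and X :: "'a \<Rightarrow> real"
  assumes summable_b: "summable (\<lambda>j. \<bar>b j\<bar>)" and b_le: "\<And>j. \<bar>b j\<bar> \<le> \<beta>"
  defines "X \<equiv> \<lambda>\<omega>. \<Sum>j. b j * Y j \<omega>"
begin

lemma summable_b_sq: "summable (\<lambda>j. (b j)\<^sup>2)"
proof (rule summable_comparison_test')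
  show "summable (\<lambda>j. \<beta> * \<bar>b j\<bar>)" using summable_b by (rule summable_mult)
  show "norm ((b j)\<^sup>2) \<le> \<beta> * \<bar>b j\<bar>" for j
  proof -
    have "(b j)\<^sup>2 = \<bar>b j\<bar> * \<bar>b j\<bar>" by (simp add: power2_eq_square)
    also have "\<dots> \<le> \<beta> * \<bar>b j\<bar>" by (rule mult_right_mono[OF b_le]) simp
    finally show ?thesis by simp
  qed
qed

lemma summable_expectation_weighted: "summable (\<lambda>j. expectation (\<lambda>\<omega>. \<bar>b j * Y j \<omega>\<bar>))"
proof -
  have "expectation (\<lambda>\<omega>. \<bar>b j * Y j \<omega>\<bar>) = \<bar>b j\<bar> * expectation (\<lambda>\<omega>. \<bar>Y 0 \<omega>\<bar>)" for j
    using transfer_expectation[of "abs" j] by (simp add: abs_mult)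
  then show ?thesis using summable_mult2[OF summable_b] by simp
qed

lemma AE_summable_weighted: "AE \<omega> in M. summable (\<lambda>j. \<bar>b j * Y j \<omega>\<bar>)"
  by (rule AE_summable_of_summable_expectation[OF _ summable_expectation_weighted]) simp

lemma X_measurable [measurable]: "random_variable borel X"
  unfolding X_def by measurable

lemma AE_partial_sums_tendsto: "AE \<omega> in M. (\<lambda>n. \<Sum>j<n. b j * Y j \<omega>) \<longlonglongrightarrow> X \<omega>"
  using AE_summable_weighted unfolding X_def
  by eventually_elim (auto intro: summable_LIMSEQ summable_rabs_cancel)

lemma integrable_series: "integrable M X"
  unfolding X_def using AE_summable_weighted summable_expectation_weighted
  by (intro integrable_suminf) auto

lemma expectation_series: "expectation X = 0"
proof -
  have "expectation X = (\<Sum>j. expectation (\<lambda>\<omega>. b j * Y j \<omega>))"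
    unfolding X_def using AE_summable_weighted summable_expectation_weighted
    by (intro integral_suminf) auto
  then show ?thesis by simp
qed

text \<open>
The bound passes from the partial sums to the almost sure limit by Fatou's lemma.
\<close>

lemma series_second_moment:
  shows integrable_series_sq: "integrable M (\<lambda>\<omega>. (X \<omega>)\<^sup>2)"
    and expectation_series_sq_le: "expectation (\<lambda>\<omega>. (X \<omega>)\<^sup>2) \<le> V * (\<Sum>j. (b j)\<^sup>2)"
proof -
  let ?S = "\<lambda>n \<omega>. \<Sum>j<n. b j * Y j \<omega>"
  let ?B = "V * (\<Sum>j. (b j)\<^sup>2)"
  have B_nonneg: "0 \<le> ?B" using V_nonneg summable_b_sq by (simp add: suminf_nonneg)
  have "(\<integral>\<^sup>+ \<omega>. ennreal ((X \<omega>)\<^sup>2) \<partial>M) = (\<integral>\<^sup>+ \<omega>. liminf (\<lambda>n. ennreal ((?S n \<omega>)\<^sup>2)) \<partial>M)"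
  proof (rule nn_integral_cong_AE)
    show "AE \<omega> in M. ennreal ((X \<omega>)\<^sup>2) = liminf (\<lambda>n. ennreal ((?S n \<omega>)\<^sup>2))"
      using AE_partial_sums_tendsto
    proof eventually_elim
      case (elim \<omega>)
      then have "(\<lambda>n. ennreal ((?S n \<omega>)\<^sup>2)) \<longlonglongrightarrow> ennreal ((X \<omega>)\<^sup>2)"
        by (intro tendsto_ennrealI tendsto_power)
      then show ?case by (intro lim_imp_Liminf[symmetric]) auto
    qed
  qed
  also have "\<dots> \<le> liminf (\<lambda>n. \<integral>\<^sup>+ \<omega>. ennreal ((?S n \<omega>)\<^sup>2) \<partial>M)"
    by (rule nn_integral_liminf) measurable
  also have "\<dots> \<le> ennreal ?B"
  proof (rule Liminf_le)
    show "\<forall>\<^sub>F n in sequentially. (\<integral>\<^sup>+ \<omega>. ennreal ((?S n \<omega>)\<^sup>2) \<partial>M) \<le> ennreal ?B"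
    proof (intro always_eventually allI)
      fix n
      have "(\<integral>\<^sup>+ \<omega>. ennreal ((?S n \<omega>)\<^sup>2) \<partial>M) = ennreal (V * (\<Sum>j<n. (b j)\<^sup>2))"
        using partial_sum_second_moment[where n = n and b = b] by (subst nn_integral_eq_integral) auto
      also have "\<dots> \<le> ennreal ?B"
        by (intro ennreal_leI mult_left_mono V_nonneg sum_le_suminf summable_b_sq) auto
      finally show "(\<integral>\<^sup>+ \<omega>. ennreal ((?S n \<omega>)\<^sup>2) \<partial>M) \<le> ennreal ?B" .
    qed
  qed simp
  finally have le: "(\<integral>\<^sup>+ \<omega>. ennreal ((X \<omega>)\<^sup>2) \<partial>M) \<le> ennreal ?B" .
  then show int: "integrable M (\<lambda>\<omega>. (X \<omega>)\<^sup>2)"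
    by (intro integrableI_bounded) (auto simp: le_less_trans[OF le])
  from le show "expectation (\<lambda>\<omega>. (X \<omega>)\<^sup>2) \<le> ?B"
    using B_nonneg by (subst (asm) nn_integral_eq_integral[OF int]) (auto simp: ennreal_le_iff)
qed

text \<open>
A quantitative Lindeberg argument. The characteristic function of a partial sum is a product, and
so is the Gaussian one; all factors have modulus at most \<open>1\<close>, so the products differ by at
most the sum of the differences of the factors. Each factor agrees with its Gaussian counterpart
to second order, with an error of size \<open>(s * b j)\<^sup>2\<close> times a quantity that is small when
\<open>s * \<beta>\<close> is small, \<open>\<beta>\<close> being a bound for the weights. The estimate is thus strong when
\<open>s\<^sup>2 * (\<Sum>j. (b j)\<^sup>2)\<close> stays bounded and no single summand dominates.
\<close>

lemma series_char_approx:
  "cmod ((CLINT \<omega>|M. iexp (s * X \<omega>)) - exp (- (s\<^sup>2 * (V * (\<Sum>j. (b j)\<^sup>2)) / 2)))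
    \<le> s\<^sup>2 * (\<Sum>j. (b j)\<^sup>2) * (expectation (\<lambda>\<omega>. min (6 * (Y 0 \<omega>)\<^sup>2) (\<bar>s * \<beta>\<bar> * \<bar>Y 0 \<omega>\<bar> ^ 3)) / 6
        + (s * \<beta>)\<^sup>2 * V\<^sup>2 / 8)"
proof -
  define \<epsilon> where "\<epsilon> = expectation (\<lambda>\<omega>. min (6 * (Y 0 \<omega>)\<^sup>2) (\<bar>s * \<beta>\<bar> * \<bar>Y 0 \<omega>\<bar> ^ 3)) / 6
        + (s * \<beta>)\<^sup>2 * V\<^sup>2 / 8"
  let ?S = "\<lambda>n \<omega>. \<Sum>j<n. b j * Y j \<omega>"
  let ?B = "\<Sum>j. (b j)\<^sup>2"
  let ?\<phi> = "char (distr M borel (Y 0))"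
  let ?g = "\<lambda>t. exp (- (t\<^sup>2 * V / 2))"
  have \<epsilon>_nonneg: "0 \<le> \<epsilon>" unfolding \<epsilon>_def by (intro add_nonneg_nonneg divide_nonneg_nonneg integral_nonneg_AE) auto
  have min_int: "integrable M (\<lambda>\<omega>. min (6 * (Y 0 \<omega>)\<^sup>2) (c * \<bar>Y 0 \<omega>\<bar> ^ 3))" if "0 \<le> c" for c
    by (rule Bochner_Integration.integrable_bound[where f = "\<lambda>\<omega>. 6 * (Y 0 \<omega>)\<^sup>2"]) (use that in auto)
  interpret Y0: real_distribution "distr M borel (Y 0)" by (rule real_distribution_distr) simp
  have factor: "cmod (?\<phi> (s * b j) - ?g (s * b j)) \<le> (s * b j)\<^sup>2 * \<epsilon>" for j
  proof -
    let ?t = "s * b j"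
    have t_le: "\<bar>?t\<bar> \<le> \<bar>s * \<beta>\<bar>"
      using b_le[of j] by (auto simp: abs_mult intro!: mult_left_mono)
    have "cmod (?\<phi> ?t - (1 - ?t\<^sup>2 * V / 2)) \<le> ?t\<^sup>2 / 6 * expectation (\<lambda>\<omega>. min (6 * (Y 0 \<omega>)\<^sup>2) (\<bar>?t\<bar> * \<bar>Y 0 \<omega>\<bar> ^ 3))"
      by (rule char_approx3') auto
    also have "\<dots> \<le> ?t\<^sup>2 / 6 * expectation (\<lambda>\<omega>. min (6 * (Y 0 \<omega>)\<^sup>2) (\<bar>s * \<beta>\<bar> * \<bar>Y 0 \<omega>\<bar> ^ 3))"
      by (intro mult_left_mono integral_mono min_int min.mono mult_right_mono t_le) auto
    finally have 1: "cmod (?\<phi> ?t - (1 - ?t\<^sup>2 * V / 2)) \<le> \<dots>" .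
    have "cmod (of_real (1 - ?t\<^sup>2 * V / 2) - of_real (?g ?t)) = \<bar>?g ?t - (1 - ?t\<^sup>2 * V / 2)\<bar>"
      unfolding of_real_diff[symmetric] norm_of_real by simp
    also have "\<dots> \<le> (?t\<^sup>2 * V / 2)\<^sup>2 / 2"
      using V_nonneg by (intro exp_minus_second_order) auto
    also have "\<dots> = ?t\<^sup>2 * (?t\<^sup>2 * V\<^sup>2 / 8)" by (simp add: power2_eq_square)
    also have "\<dots> \<le> ?t\<^sup>2 * ((s * \<beta>)\<^sup>2 * V\<^sup>2 / 8)"
      using t_le by (intro mult_left_mono divide_right_mono mult_right_mono) (auto simp: abs_le_square_iff)
    finally have 2: "cmod (of_real (1 - ?t\<^sup>2 * V / 2) - of_real (?g ?t)) \<le> \<dots>" .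
    have "cmod (?\<phi> ?t - ?g ?t) \<le> cmod (?\<phi> ?t - (1 - ?t\<^sup>2 * V / 2)) + cmod (of_real (1 - ?t\<^sup>2 * V / 2) - of_real (?g ?t))"
      by (rule order_trans[OF _ norm_triangle_ineq]) simp
    also have "\<dots> \<le> ?t\<^sup>2 * \<epsilon>"
      using add_mono[OF 1 2] by (simp add: \<epsilon>_def algebra_simps)
    finally show ?thesis .
  qed
  have partial: "cmod ((CLINT \<omega>|M. iexp (s * ?S n \<omega>)) - exp (- (s\<^sup>2 * (V * (\<Sum>j<n. (b j)\<^sup>2)) / 2))) \<le> s\<^sup>2 * ?B * \<epsilon>" for n
  proof -
    have char_scaled: "char (distr M borel (\<lambda>\<omega>. b j * Y j \<omega>)) s = ?\<phi> (s * b j)" for j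
      unfolding ident[of j, symmetric] by (simp add: char_def integral_distr mult.assoc)
    have "(CLINT \<omega>|M. iexp (s * ?S n \<omega>)) = char (distr M borel (?S n)) s"
      by (simp add: char_def integral_distr)
    also have "\<dots> = (\<Prod>j<n. ?\<phi> (s * b j))"
      by (simp add: char_distr_sum[OF indep_weighted] char_scaled)
    finally have lhs: "(CLINT \<omega>|M. iexp (s * ?S n \<omega>)) = (\<Prod>j<n. ?\<phi> (s * b j))" .
    have "exp (- (s\<^sup>2 * (V * (\<Sum>j<n. (b j)\<^sup>2)) / 2)) = (\<Prod>j<n. ?g (s * b j))"
      unfolding exp_sum[OF finite_lessThan, symmetric]
      by (intro arg_cong[where f = exp])
        (simp add: sum_distrib_left sum_divide_distrib sum_negf power_mult_distrib mult_ac)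
    then have rhs: "complex_of_real (exp (- (s\<^sup>2 * (V * (\<Sum>j<n. (b j)\<^sup>2)) / 2))) = (\<Prod>j<n. of_real (?g (s * b j)))"
      by simp
    have "cmod ((\<Prod>j<n. ?\<phi> (s * b j)) - (\<Prod>j<n. of_real (?g (s * b j)))) \<le> (\<Sum>j<n. cmod (?\<phi> (s * b j) - of_real (?g (s * b j))))"
      by (rule norm_prod_diff) (use V_nonneg Y0.cmod_char_le_1 in auto)
    also have "\<dots> \<le> (\<Sum>j<n. (s * b j)\<^sup>2 * \<epsilon>)"
      by (intro sum_mono factor)
    also have "\<dots> = s\<^sup>2 * (\<Sum>j<n. (b j)\<^sup>2) * \<epsilon>"
      by (simp add: power_mult_distrib sum_distrib_left sum_distrib_right)
    also have "\<dots> \<le> s\<^sup>2 * ?B * \<epsilon>"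
      by (intro mult_right_mono mult_left_mono sum_le_suminf summable_b_sq \<epsilon>_nonneg) auto
    finally show ?thesis unfolding lhs rhs .
  qed
  \<comment> \<open>The bound for partial sums is uniform in their length, so it survives the limit.\<close>
  have "(\<lambda>n. CLINT \<omega>|M. iexp (s * ?S n \<omega>)) \<longlonglongrightarrow> (CLINT \<omega>|M. iexp (s * X \<omega>))"
  proof (rule integral_dominated_convergence[where w = "\<lambda>_. 1"])
    show "AE \<omega> in M. (\<lambda>n. iexp (s * ?S n \<omega>)) \<longlonglongrightarrow> iexp (s * X \<omega>)"
      using AE_partial_sums_tendsto by eventually_elim (intro tendsto_exp tendsto_mult tendsto_const tendsto_of_real)
  qed auto
  moreover have "(\<lambda>n. complex_of_real (exp (- (s\<^sup>2 * (V * (\<Sum>j<n. (b j)\<^sup>2)) / 2)))) \<longlonglongrightarrow> exp (- (s\<^sup>2 * (V * ?B) / 2))"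
    by (intro tendsto_of_real tendsto_exp tendsto_minus tendsto_divide tendsto_mult tendsto_const summable_LIMSEQ summable_b_sq) simp
  ultimately have "(\<lambda>n. cmod ((CLINT \<omega>|M. iexp (s * ?S n \<omega>)) - exp (- (s\<^sup>2 * (V * (\<Sum>j<n. (b j)\<^sup>2)) / 2))))
     \<longlonglongrightarrow> cmod ((CLINT \<omega>|M. iexp (s * X \<omega>)) - exp (- (s\<^sup>2 * (V * ?B) / 2)))"
    by (intro tendsto_norm tendsto_diff)
  from LIMSEQ_le_const2[OF this] partial show ?thesis
    unfolding \<epsilon>_def by blast
qed

end
end

section \<open>The random Poisson parameter as a weighted sum\<close>

lemma integral_exp_mesh:
  fixes \<mu> a b :: real
  assumes "0 < \<mu>" "a \<le> b"
  shows "has_bochner_integral lborel (\<lambda>s. indicator {a..<b} s * exp (- \<mu> * s)) ((exp (- \<mu> * a) - exp (- \<mu> * b)) / \<mu>)"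
proof -
  have "has_bochner_integral lborel (\<lambda>s. exp (- \<mu> * s) * indicator {a..b} s) (- exp (- \<mu> * b) / \<mu> - - exp (- \<mu> * a) / \<mu>)"
  proof (rule has_bochner_integral_FTC_Icc_real[OF \<open>a \<le> b\<close>])
    show "((\<lambda>s. - exp (- \<mu> * s) / \<mu>) has_real_derivative exp (- \<mu> * x)) (at x)" for x
      using assms by (auto intro!: derivative_eq_intros)
    show "isCont (\<lambda>s. exp (- \<mu> * s)) x" for x
      by (intro continuous_intros)
  qed
  moreover have "- exp (- \<mu> * b) / \<mu> - - exp (- \<mu> * a) / \<mu> = (exp (- \<mu> * a) - exp (- \<mu> * b)) / \<mu>"
    by (simp add: diff_divide_distrib)
  moreover have "AE s in lborel. exp (- \<mu> * s) * indicator {a..b} s = indicator {a..<b} s * exp (- \<mu> * s)"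
    using AE_lborel_singleton[of b] by eventually_elim (auto simp: indicator_def)
  ultimately show ?thesis
    by (subst (asm) has_bochner_integral_cong_AE) auto
qed

text \<open>
The discounted length of the cell number \<open>j\<close> of the mesh, that is, the integral of
\<open>exp (- \<mu> * s)\<close> over \<open>{j * h ..< (j + 1) * h}\<close>.
\<close>

definition mesh_weight :: "real \<Rightarrow> real \<Rightarrow> nat \<Rightarrow> real" where
  "mesh_weight \<mu> h j = exp (- \<mu> * h) ^ j * (1 - exp (- \<mu> * h)) / \<mu>"

context
  fixes \<mu> h :: real
  assumes \<mu>_pos: "0 < \<mu>" and h_pos: "0 < h"
begin

lemma exp_mesh_bounds: "0 < exp (- \<mu> * h)" "exp (- \<mu> * h) < 1"
  using \<mu>_pos h_pos by auto

lemma mesh_weight_nonneg: "0 \<le> mesh_weight \<mu> h j"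
  unfolding mesh_weight_def using exp_mesh_bounds \<mu>_pos by (intro divide_nonneg_pos mult_nonneg_nonneg) auto

lemma mesh_weight_le: "mesh_weight \<mu> h j \<le> h"
proof -
  have "exp (- \<mu> * h) ^ j * (1 - exp (- \<mu> * h)) \<le> 1 * (\<mu> * h)"
    using exp_mesh_bounds exp_ge_add_one_self[of "- \<mu> * h"]
    by (intro mult_mono power_le_one) auto
  then show ?thesis unfolding mesh_weight_def using \<mu>_pos by (simp add: field_simps)
qed

lemma mesh_weight_sums: "mesh_weight \<mu> h sums (1 / \<mu>)"
proof -
  have "(\<lambda>j. exp (- \<mu> * h) ^ j * ((1 - exp (- \<mu> * h)) / \<mu>)) sums (1 / (1 - exp (- \<mu> * h)) * ((1 - exp (- \<mu> * h)) / \<mu>))"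
    using exp_mesh_bounds by (intro sums_mult2 geometric_sums) auto
  moreover have "\<mu> \<noteq> 0" "h \<noteq> 0" using \<mu>_pos h_pos by auto
  ultimately show ?thesis by (simp add: mesh_weight_def[abs_def])
qed

text \<open>
This sum determines the variance of the Poisson parameter. For a fine mesh it behaves like
\<open>h / (2 * \<mu>)\<close>, which is where the factor \<open>2\<close> in the limiting variance comes from.
\<close>

lemma mesh_weight_sq_sums:
  "(\<lambda>j. (mesh_weight \<mu> h j)\<^sup>2) sums ((1 - exp (- \<mu> * h)) / (\<mu>\<^sup>2 * (1 + exp (- \<mu> * h))))"
proof -
  let ?q = "exp (- \<mu> * h)"
  have "?q\<^sup>2 < 1" using exp_mesh_bounds by (simp add: power_less_one_iff)
  then have "(\<lambda>j. (?q\<^sup>2) ^ j * ((1 - ?q)\<^sup>2 / \<mu>\<^sup>2)) sums (1 / (1 - ?q\<^sup>2) * ((1 - ?q)\<^sup>2 / \<mu>\<^sup>2))"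
    by (intro sums_mult2 geometric_sums) auto
  moreover have "(?q\<^sup>2) ^ j * ((1 - ?q)\<^sup>2 / \<mu>\<^sup>2) = (mesh_weight \<mu> h j)\<^sup>2" for j
    by (simp add: mesh_weight_def power_mult_distrib power_divide power_mult[symmetric] mult.commute del: mult_minus_left)
  moreover have "1 / (1 - ?q\<^sup>2) * ((1 - ?q)\<^sup>2 / \<mu>\<^sup>2) = (1 - ?q) / (\<mu>\<^sup>2 * (1 + ?q))"
  proof -
    have "1 - ?q \<noteq> 0" "1 + ?q \<noteq> 0" using exp_mesh_bounds by linarith+
    moreover have "1 - ?q\<^sup>2 = (1 - ?q) * (1 + ?q)" by (simp add: power2_eq_square algebra_simps)
    ultimately show ?thesis by (simp add: power2_eq_square)
  qed
  ultimately show ?thesis by simp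
qed

text \<open>
The integral of a discounted step function is taken cell by cell; pointwise only finitely many
cells contribute to the series, and the assumption bounds the sum of the absolute integrals.
\<close>

lemma discounted_step_integral:
  fixes x :: "nat \<Rightarrow> real"
  assumes summable: "summable (\<lambda>j. \<bar>x j\<bar> * mesh_weight \<mu> h j)"
  shows "(LBINT s:{0..}. (\<Sum>j. x j * indicator {real j * h ..< (real j + 1) * h} s) * exp (- \<mu> * s))
    = (\<Sum>j. x j * mesh_weight \<mu> h j)"
proof -
  let ?I = "\<lambda>j. {real j * h ..< (real j + 1) * h}"
  have finite: "finite {j. s \<in> ?I j}" for s
  proof (rule finite_subset)
    show "{j. s \<in> ?I j} \<subseteq> {..nat \<lceil>s / h\<rceil>}"
    proof
      fix j assume "j \<in> {j. s \<in> ?I j}"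
      then have "real j \<le> s / h" using h_pos by (simp add: field_simps)
      then have "real j \<le> real (nat \<lceil>s / h\<rceil>)" by linarith
      then show "j \<in> {..nat \<lceil>s / h\<rceil>}" by simp
    qed
  qed simp
  have summable_pt: "summable (\<lambda>j. norm (x j * (indicator (?I j) s * exp (- \<mu> * s))))" for s
    by (rule summable_finite[OF finite[of s]]) (simp add: indicator_def)
  have piece: "has_bochner_integral lborel (\<lambda>s. indicator (?I j) s * exp (- \<mu> * s)) (mesh_weight \<mu> h j)" for j
  proof -
    have "real j * h \<le> (real j + 1) * h" using h_pos by simp
    moreover have "(exp (- \<mu> * (real j * h)) - exp (- \<mu> * ((real j + 1) * h))) / \<mu> = mesh_weight \<mu> h j"
    proof -
      have "exp (- \<mu> * (real j * h)) = exp (- \<mu> * h) ^ j"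
        by (simp add: exp_of_nat_mult[symmetric] mult_ac)
      moreover have "exp (- \<mu> * ((real j + 1) * h)) = exp (- \<mu> * (real j * h)) * exp (- \<mu> * h)"
        by (simp add: exp_add[symmetric] algebra_simps)
      ultimately show ?thesis by (simp add: mesh_weight_def algebra_simps)
    qed
    ultimately show ?thesis using integral_exp_mesh[OF \<mu>_pos, of "real j * h" "(real j + 1) * h"] by simp
  qed
  have rewrite: "indicator {0..} s *\<^sub>R ((\<Sum>j. x j * indicator (?I j) s) * exp (- \<mu> * s))
      = (\<Sum>j. x j * (indicator (?I j) s * exp (- \<mu> * s)))" for s
  proof -
    have "(\<Sum>j. x j * (indicator (?I j) s * exp (- \<mu> * s))) = (\<Sum>j. x j * indicator (?I j) s) * exp (- \<mu> * s)"
      unfolding mult.assoc[symmetric]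
      by (rule suminf_mult2[symmetric], rule summable_finite[OF finite[of s]]) (simp add: indicator_def)
    moreover have "(\<Sum>j. x j * indicator (?I j) s) = 0" if "s < 0"
    proof -
      have outside: "s \<notin> ?I j" for j
      proof -
        have "0 \<le> real j * h" using h_pos by simp
        with that show ?thesis unfolding atLeastLessThan_iff by linarith
      qed
      show ?thesis unfolding indicator_simps(2)[OF outside] by simp
    qed
    ultimately show ?thesis by (cases "s < 0") auto
  qed
  have norm_piece: "(LBINT s. norm (x j * (indicator (?I j) s * exp (- \<mu> * s)))) = \<bar>x j\<bar> * mesh_weight \<mu> h j" for j
    using has_bochner_integral_integral_eq[OF piece[of j]] by (simp add: abs_mult)
  have "(\<lambda>j. LBINT s. x j * (indicator (?I j) s * exp (- \<mu> * s))) sums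
      (LBINT s. (\<Sum>j. x j * (indicator (?I j) s * exp (- \<mu> * s))))"
  proof (rule sums_integral)
    show "integrable lborel (\<lambda>s. x j * (indicator (?I j) s * exp (- \<mu> * s)))" for j
      using piece[of j] unfolding has_bochner_integral_iff by (intro integrable_mult_right) (rule conjunct1)
    show "summable (\<lambda>j. LBINT s. norm (x j * (indicator (?I j) s * exp (- \<mu> * s))))"
      unfolding norm_piece by (rule summable)
  qed (use summable_pt in auto)
  then have "(\<lambda>j. x j * mesh_weight \<mu> h j) sums (LBINT s. (\<Sum>j. x j * (indicator (?I j) s * exp (- \<mu> * s))))"
    unfolding integral_mult_right_zero has_bochner_integral_integral_eq[OF piece] .
  then show ?thesis
    unfolding set_lebesgue_integral_def rewrite by (rule sums_unique)
qed

end

context prob_space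
begin

lemma subalgebra_generated_by:
  assumes [measurable]: "\<And>j. random_variable borel (Ls j)"
  shows "subalgebra M (generated_by M Ls)"
proof -
  have "(\<lambda>\<omega> j. Ls j \<omega>) \<in> measurable M (\<Pi>\<^sub>M j\<in>UNIV. borel)"
    by (rule measurable_PiM_single') auto
  then show ?thesis
    unfolding subalgebra_def generated_by_def by (simp add: sets_image_in_sets)
qed

text \<open>
Taking expectations in the conditional Poisson law. The rate \<open>R'\<close> may be replaced by a
measurable modification \<open>R\<close>; for the queue this is the almost surely convergent series.
\<close>

lemma conditionally_poisson_prob:
  assumes sub: "subalgebra M F" and cond: "conditionally_poisson M F R' Q"
    and [measurable]: "random_variable borel R" and eq: "AE \<omega> in M. R' \<omega> = R \<omega>"
  shows "prob {\<omega> \<in> space M. Q \<omega> = k} = expectation (\<lambda>\<omega>. R \<omega> ^ k / fact k * exp (- R \<omega>))"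
proof -
  interpret F: finite_measure_subalgebra M F
    by unfold_locales (rule sub)
  have [measurable]: "Q \<in> measurable M (count_space UNIV)"
    using cond by (simp add: conditionally_poisson_def)
  let ?A = "{\<omega> \<in> space M. Q \<omega> = k}"
  have "prob ?A = expectation (indicator ?A)" by simp
  also have "\<dots> = expectation (real_cond_exp M F (indicator ?A))"
    by (rule F.real_cond_exp_int(2)[symmetric]) (simp add: less_top[symmetric])
  also have "\<dots> = expectation (\<lambda>\<omega>. R \<omega> ^ k / fact k * exp (- R \<omega>))"
  proof (rule integral_cong_AE)
    have "AE \<omega> in M. real_cond_exp M F (indicator ?A) \<omega> = R' \<omega> ^ k / fact k * exp (- R' \<omega>)"
      using cond by (simp add: conditionally_poisson_def)
    with eq show "AE \<omega> in M. real_cond_exp M F (indicator ?A) \<omega> = R \<omega> ^ k / fact k * exp (- R \<omega>)"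
      by eventually_elim simp
  qed (auto intro: borel_measurable_cond_exp2)
  finally show ?thesis .
qed

end

section \<open>A non-asymptotic normal approximation for the queue length\<close>

context prob_space
begin

text \<open>
The two approximations combined: the centered queue length is nearly normal with variance
\<open>m + V * B\<close>. Here \<open>m\<close> is the mean of the Poisson parameter, hence the variance caused by
the Poisson noise, and \<open>V * B\<close> is the variance of the Poisson parameter itself, caused by
resampling the rate. Every exponent \<open>\<alpha>\<close> is covered at once; the regimes differ only in which
of the two parts is larger.
\<close>

lemma stationary_queue_char_approx:
  fixes Ls :: "nat \<Rightarrow> 'a \<Rightarrow> real" and Q :: "'a \<Rightarrow> nat" and \<alpha> \<Delta> \<mu> l V :: real and N :: nat
  assumes centered: "iid_centered M (\<lambda>j \<omega>. Ls j \<omega> - l) V"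
    and Ls_nonneg: "\<And>j. AE \<omega> in M. 0 \<le> Ls j \<omega>"
    and pos: "0 < \<Delta>" "0 < \<mu>" "1 \<le> N"
    and queue: "stationary_queue_length M \<alpha> \<Delta> \<mu> Ls N Q"
  defines "h \<equiv> \<Delta> * real N powr (- \<alpha>)" and "m \<equiv> real N * l / \<mu>"
  defines "B \<equiv> (real N)\<^sup>2 * ((1 - exp (- \<mu> * h)) / (\<mu>\<^sup>2 * (1 + exp (- \<mu> * h))))"
  shows "expectation (\<lambda>\<omega>. real (Q \<omega>)) = m"
    and "cmod ((CLINT \<omega>|M. iexp (s * (real (Q \<omega>) - m))) - complex_of_real (exp (- (s\<^sup>2 * (m + V * B) / 2))))
      \<le> \<bar>s\<bar> ^ 3 * m / 6 + s\<^sup>2 / 2 * sqrt (V * B)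
        + s\<^sup>2 * B * (expectation (\<lambda>\<omega>. min (6 * (Ls 0 \<omega> - l)\<^sup>2) (\<bar>s * (real N * h)\<bar> * \<bar>Ls 0 \<omega> - l\<bar> ^ 3)) / 6
          + (s * (real N * h))\<^sup>2 * V\<^sup>2 / 8)"
proof -
  interpret Y: iid_centered M "\<lambda>j \<omega>. Ls j \<omega> - l" V by (rule centered)
  have h_pos: "0 < h" using pos by (simp add: h_def)
  define c where "c = mesh_weight \<mu> h"
  define b where "b = (\<lambda>j. real N * c j)"
  define X where "X = (\<lambda>\<omega>. \<Sum>j. b j * (Ls j \<omega> - l))"
  define R where "R = (\<lambda>\<omega>. m + X \<omega>)"
  note c_nonneg = mesh_weight_nonneg[OF \<open>0 < \<mu>\<close> h_pos, folded c_def]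
  have c_sums: "c sums (1 / \<mu>)" unfolding c_def by (rule mesh_weight_sums[OF \<open>0 < \<mu>\<close> h_pos])
  have b_nonneg: "0 \<le> b j" for j using c_nonneg by (simp add: b_def)
  have b_sums: "b sums (real N / \<mu>)"
    using sums_mult[OF c_sums, of "real N"] by (simp add: b_def)
  have summable_b: "summable (\<lambda>j. \<bar>b j\<bar>)"
    using b_sums b_nonneg by (simp add: sums_iff)
  have b_le: "\<bar>b j\<bar> \<le> real N * h" for j
    using mesh_weight_le[OF \<open>0 < \<mu>\<close> h_pos, of j] b_nonneg[of j] by (simp add: b_def c_def mult_left_mono)
  have b_sq: "(\<Sum>j. (b j)\<^sup>2) = B"
    using sums_mult[OF mesh_weight_sq_sums[OF \<open>0 < \<mu>\<close> h_pos], of "(real N)\<^sup>2"]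
    unfolding b_def c_def B_def power_mult_distrib by (rule sums_unique[symmetric])
  have X_int: "integrable M X" and X_exp: "expectation X = 0"
    and X_sq_int: "integrable M (\<lambda>\<omega>. (X \<omega>)\<^sup>2)"
    and X_sq_le: "expectation (\<lambda>\<omega>. (X \<omega>)\<^sup>2) \<le> V * B"
    unfolding X_def b_sq[symmetric]
    using Y.integrable_series[OF summable_b b_le] Y.expectation_series[OF summable_b b_le]
      Y.integrable_series_sq[OF summable_b b_le] Y.expectation_series_sq_le[OF summable_b b_le]
    by simp_all
  have [measurable]: "random_variable borel (Ls j)" for j
  proof -
    have "random_variable borel (\<lambda>\<omega>. (Ls j \<omega> - l) + l)"
      by (intro borel_measurable_add Y.Y_measurable borel_measurable_const)
    then show ?thesis by simp
  qed
  \<comment> \<open>Almost surely all rates are nonnegative and the series converges; there the integral defining the parameter is the weighted sum of the rates.\<close>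
  have R_eq: "AE \<omega> in M. queue_parameter \<alpha> \<Delta> \<mu> Ls N \<omega> = R \<omega> \<and> 0 \<le> R \<omega>"
  proof -
    have "AE \<omega> in M. \<forall>j. 0 \<le> Ls j \<omega>" using Ls_nonneg by (simp add: AE_all_countable)
    then show ?thesis
      using Y.AE_summable_weighted[OF summable_b b_le]
    proof eventually_elim
      case (elim \<omega>)
      have "(\<lambda>j. b j * (Ls j \<omega> - l) + b j * l) sums (X \<omega> + real N / \<mu> * l)"
        unfolding X_def
        by (rule sums_add[OF summable_sums[OF summable_rabs_cancel[OF elim(2)]] sums_mult2[OF b_sums]])
      then have N_sums: "(\<lambda>j. real N * (Ls j \<omega> * c j)) sums R \<omega>"
        by (simp add: R_def m_def b_def algebra_simps)
      have "(\<lambda>j. 1 / real N * (real N * (Ls j \<omega> * c j))) sums (1 / real N * R \<omega>)"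
        by (rule sums_mult[OF N_sums])
      then have Ls_sums: "(\<lambda>j. Ls j \<omega> * c j) sums (R \<omega> / real N)"
        using pos by simp
      then have "summable (\<lambda>j. \<bar>Ls j \<omega>\<bar> * mesh_weight \<mu> h j)"
        using elim(1) by (simp add: sums_iff c_def)
      from discounted_step_integral[OF \<open>0 < \<mu>\<close> h_pos this]
      have "queue_parameter \<alpha> \<Delta> \<mu> Ls N \<omega> = real N * (\<Sum>j. Ls j \<omega> * c j)"
        unfolding queue_parameter_def resampled_rate_def c_def h_def mult.assoc by simp
      also have "\<dots> = R \<omega>"
        unfolding sums_unique[OF Ls_sums, symmetric] using pos by simp
      finally have "queue_parameter \<alpha> \<Delta> \<mu> Ls N \<omega> = R \<omega>" .
      moreover have "0 \<le> R \<omega>"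
        by (rule sums_le[OF _ sums_zero N_sums]) (use elim(1) c_nonneg in simp)
      ultimately show ?case ..
    qed
  qed
  have R_nonneg: "AE \<omega> in M. 0 \<le> R \<omega>" using R_eq by eventually_elim simp
  have R_meas [measurable]: "random_variable borel R"
    unfolding R_def using X_int by simp
  have R_int: "integrable M R" and R_exp: "expectation R = m"
    unfolding R_def using X_int X_exp by (simp_all add: prob_space)
  have R_sq_int: "integrable M (\<lambda>\<omega>. (R \<omega>)\<^sup>2)"
    unfolding R_def power2_sum using X_int X_sq_int by simp
  have R_var: "variance R \<le> V * B"
    using X_sq_le unfolding R_exp by (simp add: R_def)
  have Q_meas: "Q \<in> measurable M (count_space UNIV)"
    using queue by (simp add: stationary_queue_length_def conditionally_poisson_def)
  have weights: "prob {\<omega> \<in> space M. Q \<omega> = k} = expectation (\<lambda>\<omega>. R \<omega> ^ k / fact k * exp (- R \<omega>))" for k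
  proof (rule conditionally_poisson_prob)
    show "subalgebra M (generated_by M Ls)" by (rule subalgebra_generated_by) measurable
    show "conditionally_poisson M (generated_by M Ls) (queue_parameter \<alpha> \<Delta> \<mu> Ls N) Q"
      using queue by (simp add: stationary_queue_length_def)
    show "AE \<omega> in M. queue_parameter \<alpha> \<Delta> \<mu> Ls N \<omega> = R \<omega>"
      using R_eq by eventually_elim simp
  qed (rule R_meas)
  show "expectation (\<lambda>\<omega>. real (Q \<omega>)) = m"
    using mixed_poisson_mean[OF Q_meas R_int R_nonneg weights] R_exp by simp
  have m_nonneg: "0 \<le> m" using R_exp integral_nonneg_AE[OF R_nonneg] by simp
  let ?A = "CLINT \<omega>|M. iexp (s * (real (Q \<omega>) - m))" and ?C = "CLINT \<omega>|M. iexp (s * X \<omega>)"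
  let ?e = "exp (- (s\<^sup>2 * m / 2))" and ?f = "exp (- (s\<^sup>2 * (V * B) / 2))"
  have poisson: "cmod (?A - ?e * ?C) \<le> \<bar>s\<bar> ^ 3 * m / 6 + s\<^sup>2 / 2 * sqrt (V * B)"
  proof -
    have "cmod (?A - ?e * ?C) \<le> \<bar>s\<bar> ^ 3 * m / 6 + s\<^sup>2 / 2 * sqrt (variance R)"
      using mixed_poisson_char_approx[OF Q_meas R_int R_sq_int R_nonneg weights, of s]
      unfolding R_exp by (simp add: R_def exp_of_real[symmetric])
    also have "\<dots> \<le> \<bar>s\<bar> ^ 3 * m / 6 + s\<^sup>2 / 2 * sqrt (V * B)"
      using R_var by (intro add_left_mono mult_left_mono real_sqrt_le_mono) auto
    finally show ?thesis .
  qed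
  let ?E = "s\<^sup>2 * B * (expectation (\<lambda>\<omega>. min (6 * (Ls 0 \<omega> - l)\<^sup>2) (\<bar>s * (real N * h)\<bar> * \<bar>Ls 0 \<omega> - l\<bar> ^ 3)) / 6
          + (s * (real N * h))\<^sup>2 * V\<^sup>2 / 8)"
  have "cmod (?e * (?C - ?f)) \<le> 1 * cmod (?C - ?f)"
    unfolding norm_mult using m_nonneg by (intro mult_right_mono) auto
  also have "\<dots> \<le> ?E"
    using Y.series_char_approx[OF summable_b b_le, of s] unfolding b_sq X_def by simp
  finally have clt: "cmod (?e * (?C - ?f)) \<le> ?E" .
  have "complex_of_real (exp (- (s\<^sup>2 * (m + V * B) / 2))) = ?e * ?f"
    by (simp add: of_real_mult[symmetric] exp_add[symmetric] algebra_simps add_divide_distrib del: of_real_mult)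
  then have "?A - complex_of_real (exp (- (s\<^sup>2 * (m + V * B) / 2))) = (?A - ?e * ?C) + ?e * (?C - ?f)"
    by (simp add: algebra_simps)
  then have "cmod (?A - complex_of_real (exp (- (s\<^sup>2 * (m + V * B) / 2)))) \<le> cmod (?A - ?e * ?C) + cmod (?e * (?C - ?f))"
    by (metis norm_triangle_ineq)
  with poisson clt show "cmod (?A - complex_of_real (exp (- (s\<^sup>2 * (m + V * B) / 2))))
      \<le> \<bar>s\<bar> ^ 3 * m / 6 + s\<^sup>2 / 2 * sqrt (V * B) + ?E"
    by linarith
qed

end

section \<open>Normal laws and nondegeneracy\<close>

text \<open>
The normal law is the image of the standard one under multiplication by \<open>\<sigma>\<close>.
\<close>

lemma char_normal:
  assumes "0 < \<sigma>"
  shows "char (density lborel (\<lambda>x. ennreal (normal_density 0 \<sigma> x))) t = exp (- (\<sigma>\<^sup>2 * t\<^sup>2 / 2))"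
    and "real_distribution (density lborel (\<lambda>x. ennreal (normal_density 0 \<sigma> x)))"
proof -
  interpret std: real_distribution std_normal_distribution by (rule real_dist_normal_dist)
  have "distributed std_normal_distribution lborel (\<lambda>x. x) std_normal_density"
    by (auto simp: distributed_def intro!: measure_eqI) (auto simp: emeasure_distr)
  from std.normal_density_affine[OF this, of \<sigma> 0] assms
  have "distributed std_normal_distribution lborel (\<lambda>x. \<sigma> * x) (normal_density 0 \<sigma>)" by simp
  then have eq: "density lborel (\<lambda>x. ennreal (normal_density 0 \<sigma> x)) = distr std_normal_distribution lborel (\<lambda>x. \<sigma> * x)"
    by (simp add: distributed_def)
  have "char (density lborel (\<lambda>x. ennreal (normal_density 0 \<sigma> x))) t = char std_normal_distribution (t * \<sigma>)"
    unfolding eq char_def by (subst integral_distr) (auto simp: mult_ac)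
  also have "\<dots> = exp (- (\<sigma>\<^sup>2 * t\<^sup>2 / 2))"
    by (simp add: char_std_normal_distribution power_mult_distrib mult_ac)
  finally show "char (density lborel (\<lambda>x. ennreal (normal_density 0 \<sigma> x))) t = exp (- (\<sigma>\<^sup>2 * t\<^sup>2 / 2))" .
  interpret p: prob_space "density lborel (\<lambda>x. ennreal (normal_density 0 \<sigma> x))"
    by (rule prob_space_normal_density[OF assms])
  show "real_distribution (density lborel (\<lambda>x. ennreal (normal_density 0 \<sigma> x)))"
    by unfold_locales auto
qed

text \<open>
A density excludes atoms. For a nonnegative rate this makes its mean and its variance strictly
positive, so that the limiting normal law is nondegenerate for every \<open>\<alpha>\<close>.
\<close>

lemma (in prob_space) not_AE_const_of_distributed_lborel:
  fixes L :: "'a \<Rightarrow> real"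
  assumes "distributed M lborel L f"
  shows "\<not> (AE \<omega> in M. L \<omega> = c)"
proof
  assume const: "AE \<omega> in M. L \<omega> = c"
  have [measurable]: "random_variable borel L" "f \<in> borel_measurable lborel"
    and distr: "distr M lborel L = density lborel f"
    using assms by (auto simp: distributed_def)
  have "AE x in lborel. 0 < f x \<longrightarrow> x \<noteq> c"
    using AE_lborel_singleton[of c] by eventually_elim simp
  then have "AE x in density lborel f. x \<noteq> c"
    by (simp add: AE_density)
  then have "AE \<omega> in M. L \<omega> \<noteq> c"
    unfolding distr[symmetric] by (subst (asm) AE_distr_iff) simp_all
  with const have "AE \<omega> in M. False" by eventually_elim simp
  then show False by simp
qed

section \<open>Asymptotics of the scaling\<close>

text \<open>
Every regime of the theorem is decided by whether an exponent is zero or negative.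
\<close>

lemma tendsto_powr_nonpos:
  assumes "e \<le> 0"
  shows "(\<lambda>N. real N powr e) \<longlonglongrightarrow> (if e = 0 then 1 else 0)"
proof (cases "e = 0")
  case True
  have "\<forall>\<^sub>F N in sequentially. real N powr e = 1"
    using eventually_gt_at_top[of 0] by eventually_elim (simp add: True)
  then show ?thesis using True by (simp add: tendsto_eventually)
next
  case False
  then show ?thesis using assms tendsto_neg_powr[OF _ filterlim_real_sequentially, of e] by simp
qed

lemma tendsto_sum_sq_weights_over_mesh:
  fixes \<mu> :: real
  assumes "0 < \<mu>"
  shows "((\<lambda>h. (1 - exp (- \<mu> * h)) / (\<mu>\<^sup>2 * (1 + exp (- \<mu> * h))) / h) \<longlongrightarrow> 1 / (2 * \<mu>)) (at 0)"
proof -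
  have "((\<lambda>h. exp (- \<mu> * h)) has_real_derivative - \<mu>) (at 0)"
    by (auto intro!: derivative_eq_intros)
  then have "((\<lambda>h. (exp (- \<mu> * h) - 1) / h) \<longlongrightarrow> - \<mu>) (at 0)"
    by (simp add: has_field_derivative_iff)
  moreover have "((\<lambda>h. exp (- \<mu> * h)) \<longlongrightarrow> exp (- \<mu> * 0)) (at 0)"
    by (intro tendsto_intros)
  ultimately have "((\<lambda>h. - ((exp (- \<mu> * h) - 1) / h) / (\<mu>\<^sup>2 * (1 + exp (- \<mu> * h)))) \<longlongrightarrow> - (- \<mu>) / (\<mu>\<^sup>2 * (1 + exp (- \<mu> * 0)))) (at 0)"
    using assms by (intro tendsto_intros) auto
  moreover have "- (- \<mu>) / (\<mu>\<^sup>2 * (1 + exp (- \<mu> * 0))) = 1 / (2 * \<mu>)"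
    using assms by (simp add: power2_eq_square)
  moreover have "- ((exp (- \<mu> * h) - 1) / h) / (\<mu>\<^sup>2 * (1 + exp (- \<mu> * h))) = (1 - exp (- \<mu> * h)) / (\<mu>\<^sup>2 * (1 + exp (- \<mu> * h))) / h" for h
    by (simp add: minus_divide_left mult_ac)
  ultimately show ?thesis by simp
qed

text \<open>
Dominated convergence, with the second moment as the dominating function: a third moment need not
exist, and the minimum makes up for it.
\<close>

lemma (in prob_space) truncated_moment_tendsto_0:
  fixes Y :: "'a \<Rightarrow> real" and u :: "nat \<Rightarrow> real"
  assumes [measurable]: "random_variable borel Y" and sq: "integrable M (\<lambda>\<omega>. (Y \<omega>)\<^sup>2)" and u: "u \<longlonglongrightarrow> 0"
  shows "(\<lambda>n. expectation (\<lambda>\<omega>. min (6 * (Y \<omega>)\<^sup>2) (\<bar>u n\<bar> * \<bar>Y \<omega>\<bar> ^ 3))) \<longlonglongrightarrow> 0"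
proof -
  have "(\<lambda>n. expectation (\<lambda>\<omega>. min (6 * (Y \<omega>)\<^sup>2) (\<bar>u n\<bar> * \<bar>Y \<omega>\<bar> ^ 3))) \<longlonglongrightarrow> expectation (\<lambda>\<omega>. 0)"
  proof (rule integral_dominated_convergence[where w = "\<lambda>\<omega>. 6 * (Y \<omega>)\<^sup>2"])
    show "AE \<omega> in M. (\<lambda>n. min (6 * (Y \<omega>)\<^sup>2) (\<bar>u n\<bar> * \<bar>Y \<omega>\<bar> ^ 3)) \<longlonglongrightarrow> 0"
    proof (rule AE_I2)
      fix \<omega>
      have "(\<lambda>n. min (6 * (Y \<omega>)\<^sup>2) (\<bar>u n\<bar> * \<bar>Y \<omega>\<bar> ^ 3)) \<longlonglongrightarrow> min (6 * (Y \<omega>)\<^sup>2) (0 * \<bar>Y \<omega>\<bar> ^ 3)"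
        by (intro tendsto_min tendsto_mult tendsto_const tendsto_rabs_zero u)
      then show "(\<lambda>n. min (6 * (Y \<omega>)\<^sup>2) (\<bar>u n\<bar> * \<bar>Y \<omega>\<bar> ^ 3)) \<longlonglongrightarrow> 0" by simp
    qed
  qed (use sq in auto)
  then show ?thesis by simp
qed

text \<open>
With \<open>s = t * N powr (- \<gamma> / 2)\<close> the two parts of the variance scale as \<open>N powr (1 - \<gamma>)\<close>
and \<open>N powr (2 - \<gamma> - \<alpha>)\<close>. The choice of \<open>\<gamma>\<close> as the maximum of \<open>1\<close> and
\<open>2 - \<alpha>\<close> makes both exponents nonpositive and the larger one zero; they vanish
exactly for \<open>\<alpha> \<ge> 1\<close> and for \<open>\<alpha> \<le> 1\<close>. The last limit says that no single resampled rate
dominates, as the Lindeberg estimate demands.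
\<close>

lemma
  fixes \<alpha> \<Delta> \<mu> t :: real
  assumes "0 < \<alpha>" "0 < \<Delta>" "0 < \<mu>"
  defines "\<gamma> \<equiv> max 1 (2 - \<alpha>)"
  defines "s \<equiv> \<lambda>N. t * real N powr (- \<gamma> / 2)" and "h \<equiv> \<lambda>N. \<Delta> * real N powr (- \<alpha>)"
  shows scaled_argument_tendsto: "s \<longlonglongrightarrow> 0"
    and scaled_poisson_variance_tendsto: "(\<lambda>N. (s N)\<^sup>2 * real N) \<longlonglongrightarrow> t\<^sup>2 * (if \<alpha> \<ge> 1 then 1 else 0)"
    and scaled_rate_variance_tendsto: "(\<lambda>N. (s N)\<^sup>2 * ((real N)\<^sup>2 * ((1 - exp (- \<mu> * h N)) / (\<mu>\<^sup>2 * (1 + exp (- \<mu> * h N))))))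
        \<longlonglongrightarrow> t\<^sup>2 * (\<Delta> / (2 * \<mu>) * (if \<alpha> \<le> 1 then 1 else 0))"
    and scaled_weight_tendsto: "(\<lambda>N. s N * (real N * h N)) \<longlonglongrightarrow> 0"
proof -
  have s2: "(s N)\<^sup>2 = t\<^sup>2 * real N powr (- \<gamma>)" for N
    by (simp add: s_def power_mult_distrib power2_eq_square powr_add[symmetric])
  have powr_mult_nat: "real N powr e * real N = real N powr (e + 1)" for e N
    by (cases "N = 0") (simp_all add: powr_add)
  have "(\<lambda>N. t * real N powr (- \<gamma> / 2)) \<longlonglongrightarrow> t * 0"
    using tendsto_powr_nonpos[of "- \<gamma> / 2"] by (intro tendsto_mult tendsto_const) (auto simp: \<gamma>_def max_def split: if_splits)
  then show "s \<longlonglongrightarrow> 0" by (simp add: s_def[abs_def])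
  have "(\<lambda>N. t\<^sup>2 * real N powr (1 - \<gamma>)) \<longlonglongrightarrow> t\<^sup>2 * (if 1 - \<gamma> = 0 then 1 else 0)"
    by (intro tendsto_mult tendsto_const tendsto_powr_nonpos) (simp add: \<gamma>_def)
  moreover have "1 - \<gamma> = 0 \<longleftrightarrow> \<alpha> \<ge> 1" by (auto simp: \<gamma>_def max_def)
  moreover have "(s N)\<^sup>2 * real N = t\<^sup>2 * real N powr (1 - \<gamma>)" for N
    unfolding s2 mult.assoc powr_mult_nat by (simp add: add.commute)
  ultimately show "(\<lambda>N. (s N)\<^sup>2 * real N) \<longlonglongrightarrow> t\<^sup>2 * (if \<alpha> \<ge> 1 then 1 else 0)" by simp
  have "2 - \<alpha> \<le> \<gamma>" by (simp add: \<gamma>_def)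
  then have exponent_neg: "1 - \<gamma> / 2 - \<alpha> < 0" using \<open>0 < \<alpha>\<close> by linarith
  then have "(\<lambda>N. t * \<Delta> * real N powr (1 - \<gamma> / 2 - \<alpha>)) \<longlonglongrightarrow> t * \<Delta> * (if 1 - \<gamma> / 2 - \<alpha> = 0 then 1 else 0)"
    by (intro tendsto_mult tendsto_const tendsto_powr_nonpos) simp
  moreover have "1 - \<gamma> / 2 - \<alpha> \<noteq> 0" using exponent_neg by simp
  moreover have "s N * (real N * h N) = t * \<Delta> * real N powr (1 - \<gamma> / 2 - \<alpha>)" for N
  proof -
    have "s N * (real N * h N) = t * \<Delta> * (real N powr (- \<gamma> / 2) * real N * real N powr (- \<alpha>))"
      by (simp add: s_def h_def)
    then show ?thesis unfolding powr_mult_nat powr_add[symmetric] by (simp add: algebra_simps)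
  qed
  ultimately show "(\<lambda>N. s N * (real N * h N)) \<longlonglongrightarrow> 0" by simp
  have "h \<longlonglongrightarrow> \<Delta> * 0"
    unfolding h_def using tendsto_powr_nonpos[of "- \<alpha>"] assms by (intro tendsto_mult tendsto_const) auto
  moreover have "\<forall>\<^sub>F N in sequentially. h N \<noteq> 0"
    using eventually_gt_at_top[of 0] by eventually_elim (use assms in \<open>simp add: h_def\<close>)
  ultimately have "filterlim h (at 0) sequentially" by (simp add: filterlim_at)
  from filterlim_compose[OF tendsto_sum_sq_weights_over_mesh[OF \<open>0 < \<mu>\<close>] this]
  have ratio: "(\<lambda>N. (1 - exp (- \<mu> * h N)) / (\<mu>\<^sup>2 * (1 + exp (- \<mu> * h N))) / h N) \<longlonglongrightarrow> 1 / (2 * \<mu>)" .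
  have "(\<lambda>N. t\<^sup>2 * \<Delta> * real N powr (2 - \<gamma> - \<alpha>) * ((1 - exp (- \<mu> * h N)) / (\<mu>\<^sup>2 * (1 + exp (- \<mu> * h N))) / h N))
     \<longlonglongrightarrow> t\<^sup>2 * \<Delta> * (if 2 - \<gamma> - \<alpha> = 0 then 1 else 0) * (1 / (2 * \<mu>))"
    by (intro tendsto_mult tendsto_const tendsto_powr_nonpos ratio) (auto simp: \<gamma>_def)
  moreover have "2 - \<gamma> - \<alpha> = 0 \<longleftrightarrow> \<alpha> \<le> 1" by (auto simp: \<gamma>_def max_def)
  moreover have "t\<^sup>2 * \<Delta> * real N powr (2 - \<gamma> - \<alpha>) * ((1 - exp (- \<mu> * h N)) / (\<mu>\<^sup>2 * (1 + exp (- \<mu> * h N))) / h N)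
      = (s N)\<^sup>2 * ((real N)\<^sup>2 * ((1 - exp (- \<mu> * h N)) / (\<mu>\<^sup>2 * (1 + exp (- \<mu> * h N)))))" for N
  proof (cases "N = 0")
    case False
    have "(s N)\<^sup>2 * (real N)\<^sup>2 * h N = t\<^sup>2 * \<Delta> * (real N powr (- \<gamma>) * real N * real N * real N powr (- \<alpha>))"
      unfolding s2 by (simp add: h_def power2_eq_square)
    also have "\<dots> = t\<^sup>2 * \<Delta> * real N powr (2 - \<gamma> - \<alpha>)"
      unfolding powr_mult_nat powr_add[symmetric] by (simp add: algebra_simps)
    finally have "t\<^sup>2 * \<Delta> * real N powr (2 - \<gamma> - \<alpha>) = (s N)\<^sup>2 * (real N)\<^sup>2 * h N" ..
    moreover have "h N \<noteq> 0" using False assms by (simp add: h_def)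
    ultimately show ?thesis by simp
  qed (simp add: s_def)
  ultimately show "(\<lambda>N. (s N)\<^sup>2 * ((real N)\<^sup>2 * ((1 - exp (- \<mu> * h N)) / (\<mu>\<^sup>2 * (1 + exp (- \<mu> * h N))))))
        \<longlonglongrightarrow> t\<^sup>2 * (\<Delta> / (2 * \<mu>) * (if \<alpha> \<le> 1 then 1 else 0))"
    by (cases "\<alpha> \<le> 1") simp_all
qed

section \<open>Convergence in distribution\<close>

theorem theorem2p1:
  fixes M :: "'a measure"
    and L :: "'a \<Rightarrow> real" and f :: "real \<Rightarrow> ennreal"
    and Ls :: "nat \<Rightarrow> 'a \<Rightarrow> real"
    and Q :: "nat \<Rightarrow> 'a \<Rightarrow> nat"
    and \<alpha> \<Delta> \<mu> \<sigma>2 :: real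
  assumes "prob_space M"
    and "\<alpha> > 0" and "\<Delta> > 0" and "\<mu> > 0"
    and "distributed M lborel L f"
    and "AE \<omega> in M. 0 \<le> L \<omega>"
    and "integrable M L" and "integrable M (\<lambda>\<omega>. (L \<omega>)\<^sup>2)"
    and "prob_space.indep_vars M (\<lambda>_. borel) Ls UNIV"
    and "\<And>j. distr M borel (Ls j) = distr M borel L"
    and "\<And>N. N \<ge> 1 \<Longrightarrow> stationary_queue_length M \<alpha> \<Delta> \<mu> Ls N (Q N)"
    and "\<sigma>2 = prob_space.expectation M L / \<mu> * (if \<alpha> \<ge> 1 then 1 else 0)
              + \<Delta> * prob_space.variance M L / (2 * \<mu>) * (if \<alpha> \<le> 1 then 1 else 0)"
  shows "weak_conv_m (\<lambda>N. distr M borel (normalized_queue_length M \<alpha> N (Q N)))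
           (density lborel (\<lambda>x. ennreal (normal_density 0 (sqrt \<sigma>2) x)))"
proof -
  interpret prob_space M by (rule assms(1))
  note pos = \<open>\<alpha> > 0\<close> \<open>\<Delta> > 0\<close> \<open>\<mu> > 0\<close>
  define l where "l = expectation L"
  define V where "V = variance L"
  have L_meas [measurable]: "random_variable borel L" using assms(7) by simp
  have Ls_meas [measurable]: "random_variable borel (Ls j)" for j
    using assms(9) by (simp add: indep_vars_def)
  have Ls_nonneg: "AE \<omega> in M. 0 \<le> Ls j \<omega>" for j
  proof -
    have "AE x in distr M borel L. 0 \<le> x" using assms(6) by (subst AE_distr_iff) auto
    then show ?thesis unfolding assms(10)[of j, symmetric] by (subst (asm) AE_distr_iff) auto
  qed
  have same_expectation: "expectation (\<lambda>\<omega>. g (Ls 0 \<omega>)) = expectation (\<lambda>\<omega>. g (L \<omega>))"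
    if [measurable]: "g \<in> borel_measurable borel" for g :: "real \<Rightarrow> real"
  proof -
    have "expectation (\<lambda>\<omega>. g (Ls 0 \<omega>)) = integral\<^sup>L (distr M borel (Ls 0)) g" by (simp add: integral_distr)
    also have "\<dots> = expectation (\<lambda>\<omega>. g (L \<omega>))" unfolding assms(10) by (simp add: integral_distr)
    finally show ?thesis .
  qed
  have same_integrable: "integrable M (\<lambda>\<omega>. g (Ls 0 \<omega>)) \<longleftrightarrow> integrable M (\<lambda>\<omega>. g (L \<omega>))"
    if [measurable]: "g \<in> borel_measurable borel" for g :: "real \<Rightarrow> real"
  proof -
    have "integrable M (\<lambda>\<omega>. g (Ls 0 \<omega>)) \<longleftrightarrow> integrable (distr M borel (Ls 0)) g" by (simp add: integrable_distr_eq)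
    also have "\<dots> \<longleftrightarrow> integrable M (\<lambda>\<omega>. g (L \<omega>))" unfolding assms(10) by (simp add: integrable_distr_eq)
    finally show ?thesis .
  qed
  have centered: "iid_centered M (\<lambda>j \<omega>. Ls j \<omega> - l) V"
  proof
    show "indep_vars (\<lambda>_. borel) (\<lambda>j \<omega>. Ls j \<omega> - l) UNIV"
      by (rule indep_vars_compose2[OF assms(9)]) simp
    have "distr M borel (\<lambda>\<omega>. Ls j \<omega> - l) = distr (distr M borel L) borel (\<lambda>x. x - l)" for j
      unfolding assms(10)[of j, symmetric] by (subst distr_distr) (auto simp: comp_def)
    then show "distr M borel (\<lambda>\<omega>. Ls j \<omega> - l) = distr M borel (\<lambda>\<omega>. Ls 0 \<omega> - l)" for j by simp
    show "integrable M (\<lambda>\<omega>. (Ls 0 \<omega> - l)\<^sup>2)"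
      using assms(7,8) by (subst same_integrable[of "\<lambda>x. (x - l)\<^sup>2"]) (auto simp: power2_diff)
    show "expectation (\<lambda>\<omega>. Ls 0 \<omega> - l) = 0"
      using assms(7) by (subst same_expectation[of "\<lambda>x. x - l"]) (auto simp: l_def prob_space)
    show "V = expectation (\<lambda>\<omega>. (Ls 0 \<omega> - l)\<^sup>2)"
      by (subst same_expectation[of "\<lambda>x. (x - l)\<^sup>2"]) (auto simp: V_def l_def)
  qed
  have l_pos: "0 < l"
  proof -
    have "l \<noteq> 0"
      unfolding l_def integral_nonneg_eq_0_iff_AE[OF assms(7,6)]
      by (rule not_AE_const_of_distributed_lborel[OF assms(5)])
    then show ?thesis using integral_nonneg_AE[OF assms(6)] by (simp add: l_def)
  qed
  have V_pos: "0 < V"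
  proof -
    have int: "integrable M (\<lambda>\<omega>. (L \<omega> - l)\<^sup>2)" using assms(7,8) by (simp add: power2_diff)
    have "V \<noteq> 0"
      unfolding V_def l_def[symmetric] using not_AE_const_of_distributed_lborel[OF assms(5), of l]
      by (subst integral_nonneg_eq_0_iff_AE[OF int]) auto
    then show ?thesis using variance_positive[of L] unfolding V_def by linarith
  qed
  have \<sigma>2: "\<sigma>2 = l / \<mu> * (if \<alpha> \<ge> 1 then 1 else 0) + V * (\<Delta> / (2 * \<mu>) * (if \<alpha> \<le> 1 then 1 else 0))"
    unfolding assms(12) l_def V_def by simp
  have \<sigma>2_pos: "0 < \<sigma>2"
    unfolding \<sigma>2 using l_pos V_pos pos by (cases "\<alpha> \<ge> 1"; cases "\<alpha> \<le> 1") (auto intro!: add_pos_pos divide_pos_pos mult_pos_pos)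
  have Q_meas: "Q N \<in> measurable M (count_space UNIV)" if "1 \<le> N" for N
    using assms(11)[OF that] by (simp add: stationary_queue_length_def conditionally_poisson_def)
  \<comment> \<open>For \<open>N = 0\<close> the factor \<open>0 powr _ = 0\<close> makes the normalized variable constant, whatever \<open>Q 0\<close> is.\<close>
  have normalized_meas: "random_variable borel (normalized_queue_length M \<alpha> N (Q N))" for N
  proof (cases "N = 0")
    case True
    then show ?thesis by (simp add: normalized_queue_length_def[abs_def])
  next
    case False
    then have [measurable]: "Q N \<in> measurable M (count_space UNIV)" by (intro Q_meas) simp
    show ?thesis unfolding normalized_queue_length_def[abs_def] by measurable
  qed
  have convergence: "(\<lambda>N. char (distr M borel (normalized_queue_length M \<alpha> N (Q N))) t) \<longlonglongrightarrow> exp (- (\<sigma>2 * t\<^sup>2 / 2))" for t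
  proof -
    define s where "s = (\<lambda>N. t * real N powr (- (max 1 (2 - \<alpha>)) / 2))"
    define h where "h = (\<lambda>N. \<Delta> * real N powr (- \<alpha>))"
    define m where "m = (\<lambda>N. real N * l / \<mu>)"
    define B where "B = (\<lambda>N. (real N)\<^sup>2 * ((1 - exp (- \<mu> * h N)) / (\<mu>\<^sup>2 * (1 + exp (- \<mu> * h N)))))"
    define err where "err = (\<lambda>N. \<bar>s N\<bar> ^ 3 * m N / 6 + (s N)\<^sup>2 / 2 * sqrt (V * B N)
        + (s N)\<^sup>2 * B N * (expectation (\<lambda>\<omega>. min (6 * (Ls 0 \<omega> - l)\<^sup>2) (\<bar>s N * (real N * h N)\<bar> * \<bar>Ls 0 \<omega> - l\<bar> ^ 3)) / 6
          + (s N * (real N * h N))\<^sup>2 * V\<^sup>2 / 8))"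
    define b where "b = t\<^sup>2 * (\<Delta> / (2 * \<mu>) * (if \<alpha> \<le> 1 then 1 else 0))"
    define a where "a = t\<^sup>2 * (if \<alpha> \<ge> 1 then 1 else 0) * (l / \<mu>)"
    have s_lim: "s \<longlonglongrightarrow> 0"
      unfolding s_def by (rule scaled_argument_tendsto[OF pos])
    have "(\<lambda>N. (s N)\<^sup>2 * real N * (l / \<mu>)) \<longlonglongrightarrow> a"
      unfolding s_def a_def by (intro tendsto_mult[OF scaled_poisson_variance_tendsto[OF pos] tendsto_const])
    then have m_lim: "(\<lambda>N. (s N)\<^sup>2 * m N) \<longlonglongrightarrow> a"
      by (simp add: m_def mult.assoc)
    have B_lim: "(\<lambda>N. (s N)\<^sup>2 * B N) \<longlonglongrightarrow> b"
      unfolding s_def B_def h_def b_def by (rule scaled_rate_variance_tendsto[OF pos])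
    have weight_lim: "(\<lambda>N. s N * (real N * h N)) \<longlonglongrightarrow> 0"
      unfolding s_def h_def by (rule scaled_weight_tendsto[OF pos])
    \<comment> \<open>As \<open>s\<^sup>2 * m\<close> and \<open>s\<^sup>2 * B\<close> converge, the first two error terms are bounded multiples of \<open>\<bar>s\<bar>\<close>
      (for the second, \<open>s\<^sup>2 * sqrt B = \<bar>s\<bar> * sqrt (s\<^sup>2 * B)\<close>), and the third is a bounded multiple of the
      Lindeberg term.\<close>
    have err_lim: "err \<longlonglongrightarrow> 0"
    proof -
      have "(\<lambda>N. \<bar>s N\<bar> * ((s N)\<^sup>2 * m N) / 6) \<longlonglongrightarrow> 0 * a / 6"
        by (intro tendsto_intros tendsto_rabs_zero s_lim m_lim) simp
      moreover have "\<bar>s N\<bar> * ((s N)\<^sup>2 * m N) / 6 = \<bar>s N\<bar> ^ 3 * m N / 6" for N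
        by (simp add: power3_eq_cube power2_eq_square)
      ultimately have 1: "(\<lambda>N. \<bar>s N\<bar> ^ 3 * m N / 6) \<longlonglongrightarrow> 0" by simp
      have "(\<lambda>N. \<bar>s N\<bar> / 2 * sqrt (V * ((s N)\<^sup>2 * B N))) \<longlonglongrightarrow> 0 / 2 * sqrt (V * b)"
        by (intro tendsto_intros tendsto_rabs_zero s_lim B_lim) simp
      moreover have "\<bar>s N\<bar> / 2 * sqrt (V * ((s N)\<^sup>2 * B N)) = (s N)\<^sup>2 / 2 * sqrt (V * B N)" for N
      proof -
        have "sqrt (V * ((s N)\<^sup>2 * B N)) = \<bar>s N\<bar> * sqrt (V * B N)"
          by (simp add: real_sqrt_mult)
        then show ?thesis by (simp add: power2_eq_square)
      qed
      ultimately have 2: "(\<lambda>N. (s N)\<^sup>2 / 2 * sqrt (V * B N)) \<longlonglongrightarrow> 0" by simp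
      have "(\<lambda>N. expectation (\<lambda>\<omega>. min (6 * (Ls 0 \<omega> - l)\<^sup>2) (\<bar>s N * (real N * h N)\<bar> * \<bar>Ls 0 \<omega> - l\<bar> ^ 3))) \<longlonglongrightarrow> 0"
        using iid_centered.sq_integrable[OF centered] by (intro truncated_moment_tendsto_0 weight_lim) auto
      from tendsto_mult[OF B_lim tendsto_add[OF tendsto_divide[OF this tendsto_const[of 6]]
          tendsto_divide[OF tendsto_mult[OF tendsto_power[OF weight_lim, of 2] tendsto_const[of "V\<^sup>2"]] tendsto_const[of 8]]]]
      have 3: "(\<lambda>N. (s N)\<^sup>2 * B N * (expectation (\<lambda>\<omega>. min (6 * (Ls 0 \<omega> - l)\<^sup>2) (\<bar>s N * (real N * h N)\<bar> * \<bar>Ls 0 \<omega> - l\<bar> ^ 3)) / 6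
          + (s N * (real N * h N))\<^sup>2 * V\<^sup>2 / 8)) \<longlonglongrightarrow> 0"
        by simp
      from tendsto_add[OF tendsto_add[OF 1 2] 3] show ?thesis by (simp add: err_def)
    qed
    have bound: "cmod (char (distr M borel (normalized_queue_length M \<alpha> N (Q N))) t
        - exp (- (((s N)\<^sup>2 * m N + V * ((s N)\<^sup>2 * B N)) / 2))) \<le> err N" if "1 \<le> N" for N
    proof -
      note approx = stationary_queue_char_approx[OF centered Ls_nonneg pos(2,3) that assms(11)[OF that]]
      have "char (distr M borel (normalized_queue_length M \<alpha> N (Q N))) t
          = (CLINT \<omega>|M. iexp (s N * (real (Q N \<omega>) - m N)))"
        using normalized_meas[of N] unfolding char_def
        by (subst integral_distr) (auto simp: normalized_queue_length_def approx(1) s_def m_def mult.assoc)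
      moreover have "(s N)\<^sup>2 * (m N + V * B N) / 2 = ((s N)\<^sup>2 * m N + V * ((s N)\<^sup>2 * B N)) / 2"
        by (simp add: algebra_simps)
      ultimately show ?thesis
        using approx(2)[of "s N"] unfolding err_def B_def m_def h_def by simp
    qed
    have difference_lim: "(\<lambda>N. char (distr M borel (normalized_queue_length M \<alpha> N (Q N))) t
        - exp (- (((s N)\<^sup>2 * m N + V * ((s N)\<^sup>2 * B N)) / 2))) \<longlonglongrightarrow> 0"
      by (rule Lim_null_comparison[OF eventually_sequentiallyI[OF bound] err_lim])
    have gauss_lim: "(\<lambda>N. complex_of_real (exp (- (((s N)\<^sup>2 * m N + V * ((s N)\<^sup>2 * B N)) / 2)))) \<longlonglongrightarrow> exp (- ((a + V * b) / 2))"
      by (intro tendsto_of_real tendsto_exp tendsto_minus tendsto_divide tendsto_add tendsto_mult tendsto_const m_lim B_lim) simp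
    have "a + V * b = \<sigma>2 * t\<^sup>2"
      unfolding a_def b_def \<sigma>2 by (simp add: algebra_simps)
    with Lim_transform[OF gauss_lim difference_lim] show ?thesis by simp
  qed
  have normal: "char (density lborel (\<lambda>x. ennreal (normal_density 0 (sqrt \<sigma>2) x))) t = exp (- (\<sigma>2 * t\<^sup>2 / 2))" for t
    using char_normal(1)[of "sqrt \<sigma>2" t] \<sigma>2_pos by simp
  show ?thesis
  proof (rule levy_continuity)
    show "real_distribution (distr M borel (normalized_queue_length M \<alpha> N (Q N)))" for N
      by (rule real_distribution_distr[OF normalized_meas])
    show "real_distribution (density lborel (\<lambda>x. ennreal (normal_density 0 (sqrt \<sigma>2) x)))"
      using \<sigma>2_pos by (intro char_normal(2)) simp
    show "(\<lambda>N. char (distr M borel (normalized_queue_length M \<alpha> N (Q N))) t)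
        \<longlonglongrightarrow> char (density lborel (\<lambda>x. ennreal (normal_density 0 (sqrt \<sigma>2) x))) t" for t
      unfolding normal by (rule convergence)
  qed
qed

end
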